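(* Suppose that $f=f(x)=f(x_1,\ldots,x_g)$ is a symmetric $\kappa\times\kappa$ nc matrix polynomial such that: (1) the highest degree terms of $f$ majorize; (2) $f(0)=0$; (3) there exists a positive number $\gamma$ such that for each positive integer $n$ and each $M\in\mathbb{S}_{\kappa n}$ with $M\prec\gamma I_{\kappa n}$, the set $\{X\in\mathbb{S}_n(\mathbb{R}^g): f(X)\prec M\}$ is a proper convex subset of $\mathbb{S}_n(\mathbb{R}^g)$. Then there exist a symmetric $\kappa\times\kappa$ matrix polynomial $\ell$ that is affine linear in $x$, and finitely many $1\times\kappa$ matrices of free polynomials $s_1,\dots,s_n$, each linear in $x$ (hence homogeneous of degree one in $x$), such that $$f(x)=\ell(x)+\sum_{j=1}^n s_j(x)^Ts_j(x).$$
   Context: $x=(x_1,\dots,x_g)$ are freely noncommuting symmetric variables. A free (nc) polynomial is a finite real linear combination of words in these variables; the involution $T$ reverses words ($x_j^T=x_j$). A $\kappa\times\kappa$ nc matrix polynomial is $f=\sum_w C_w w$ (finite sum) with $C_w\in\mathbb{R}^{\kappa\times\kappa}$; $f^T=\sum_w C_w^Tw^T$, and $f$ is symmetric if $f=f^T$. $\mathbb{S}_n$ is the set of real symmetric $n\times n$ matrices and $\mathbb{S}_n(\mathbb{R}^g)$ the set of $g$-tuples $X=(X_1,\dots,X_g)$ from $\mathbb{S}_n$. Evaluation: $f(X)=\sum_w C_w\otimes w(X)\in\mathbb{R}^{n\kappa\times n\kappa}$. $A\prec B$ means $B-A$ is positive definite. Affine linear in $x$ means of degree at most one in $x$. Highest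 degree terms majorize: let $d$ be the degree of $f$, and for $1\le j\le d$ let $f^j$ be the homogeneous part of degree $j$ of $f$, $f^j=\sum_{w} C_w w$ over words $w$ of length $j$. Let $\varphi^j_f$ be the block row matrix with $\kappa\times\kappa$ blocks $C_w$, $w$ running over the words of length $j$. The highest degree terms of $f$ majorize if $\mathrm{range}\,\varphi^j_f\subseteq\mathrm{range}\,\varphi^d_f$ for $j=1,\dots,d-1$. *)

theory Defs
  imports "Jordan_Normal_Form.Matrix" "HOL-Library.FuncSet"
begin

section \<open>Real matrices\<close>

definition symmetric_mats :: "nat \<Rightarrow> real mat set" where
  "symmetric_mats n = {A \<in> carrier_mat n n. transpose_mat A = A}"

definition positive_definite :: "real mat \<Rightarrow> bool" where
  "positive_definite A \<longleftrightarrow> A \<in> symmetric_mats (dim_row A) \<and>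
     (\<forall>v \<in> carrier_vec (dim_row A). v \<noteq> 0\<^sub>v (dim_row A) \<longrightarrow> 0 < v \<bullet> (A *\<^sub>v v))"

definition loewner_less :: "real mat \<Rightarrow> real mat \<Rightarrow> bool" (infix "\<prec>\<^sub>L" 50) where
  "A \<prec>\<^sub>L B \<longleftrightarrow> positive_definite (B - A)"

definition mat_range :: "real mat \<Rightarrow> real vec set" where
  "mat_range A = {A *\<^sub>v v | v. v \<in> carrier_vec (dim_col A)}"

definition kronecker :: "real mat \<Rightarrow> real mat \<Rightarrow> real mat" (infixl "\<otimes>\<^sub>K" 70) where
  "A \<otimes>\<^sub>K B = mat (dim_row A * dim_row B) (dim_col A * dim_col B)
     (\<lambda>(i, j). A $$ (i div dim_row B, j div dim_col B) * B $$ (i mod dim_row B, j mod dim_col B))"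

text \<open>Matrices of all sizes share one type, which therefore has no canonical zero; the size
  of a sum of matrices has to be supplied.\<close>

definition matsum :: "nat \<Rightarrow> nat \<Rightarrow> ('i \<Rightarrow> real mat) \<Rightarrow> 'i set \<Rightarrow> real mat" where
  "matsum r c F I = mat r c (\<lambda>ij. \<Sum>k\<in>I. F k $$ ij)"


section \<open>Tuples of symmetric matrices\<close>

text \<open>The variables \<open>x\<^sub>1, \<dots>, x\<^sub>g\<close> are numbered \<open>0, \<dots>, g - 1\<close>.\<close>

definition sym_tuples :: "nat \<Rightarrow> nat \<Rightarrow> (nat \<Rightarrow> real mat) set" where
  "sym_tuples n g = {..<g} \<rightarrow>\<^sub>E symmetric_mats n"

definition convex_tuples :: "nat \<Rightarrow> (nat \<Rightarrow> real mat) set \<Rightarrow> bool" where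
  "convex_tuples g S \<longleftrightarrow> (\<forall>X\<in>S. \<forall>Y\<in>S. \<forall>t::real. 0 \<le> t \<and> t \<le> 1 \<longrightarrow>
     (\<lambda>i\<in>{..<g}. (1 - t) \<cdot>\<^sub>m X i + t \<cdot>\<^sub>m Y i) \<in> S)"


section \<open>Noncommutative matrix polynomials\<close>

text \<open>A matrix polynomial \<open>\<Sum>\<^sub>w C\<^sub>w w\<close> is its coefficient function \<open>w \<mapsto> C\<^sub>w\<close>. Rectangular
  coefficients are allowed: an \<open>r \<times> c\<close> matrix of free polynomials is the same thing as a
  polynomial with coefficients in \<open>\<real>\<^bsup>r\<times>c\<^esup>\<close>.\<close>

type_synonym ncpoly = "nat list \<Rightarrow> real mat"

definition ncp_support :: "ncpoly \<Rightarrow> nat list set" where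
  "ncp_support f = {w. f w \<noteq> 0\<^sub>m (dim_row (f w)) (dim_col (f w))}"

definition ncpolys :: "nat \<Rightarrow> nat \<Rightarrow> nat \<Rightarrow> ncpoly set" where
  "ncpolys g r c = {f. (\<forall>w. f w \<in> carrier_mat r c) \<and> finite (ncp_support f) \<and>
     ncp_support f \<subseteq> lists {..<g}}"

text \<open>The zero polynomial gets degree \<open>0\<close>.\<close>

definition ncp_degree :: "ncpoly \<Rightarrow> nat" where
  "ncp_degree f = Max (insert 0 (length ` ncp_support f))"

definition ncp_homogeneous :: "nat \<Rightarrow> ncpoly \<Rightarrow> bool" where
  "ncp_homogeneous j f \<longleftrightarrow> (\<forall>w \<in> ncp_support f. length w = j)"

text \<open>In \<open>f\<^sup>T = \<Sum>\<^sub>w C\<^sub>w\<^sup>T w\<^sup>T\<close> the word \<open>w\<^sup>T\<close> is the reversal of \<open>w\<close>, so the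
  coefficient of \<open>w\<close> in \<open>f\<^sup>T\<close> is the transpose of that of \<open>rev w\<close> in \<open>f\<close>.\<close>

definition ncp_transpose :: "ncpoly \<Rightarrow> ncpoly" where
  "ncp_transpose f = (\<lambda>w. transpose_mat (f (rev w)))"

definition ncp_symmetric :: "ncpoly \<Rightarrow> bool" where
  "ncp_symmetric f \<longleftrightarrow> ncp_transpose f = f"

definition ncp_add :: "ncpoly \<Rightarrow> ncpoly \<Rightarrow> ncpoly" where
  "ncp_add p q = (\<lambda>w. p w + q w)"

definition ncp_sum :: "nat \<Rightarrow> nat \<Rightarrow> ('i \<Rightarrow> ncpoly) \<Rightarrow> 'i set \<Rightarrow> ncpoly" where
  "ncp_sum r c p I = (\<lambda>w. matsum r c (\<lambda>k. p k w) I)"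

text \<open>The coefficient of \<open>w\<close> in a product sums over all factorizations \<open>w = u v\<close>. All
  coefficients of one polynomial have the same size, so it can be read off at the empty word.\<close>

definition ncp_mult :: "ncpoly \<Rightarrow> ncpoly \<Rightarrow> ncpoly" where
  "ncp_mult p q = (\<lambda>w. matsum (dim_row (p [])) (dim_col (q []))
     (\<lambda>i. p (take i w) * q (drop i w)) {..length w})"

definition word_eval :: "nat \<Rightarrow> (nat \<Rightarrow> real mat) \<Rightarrow> nat list \<Rightarrow> real mat" where
  "word_eval n X w = foldr (\<lambda>i A. X i * A) w (1\<^sub>m n)"

definition ncp_eval :: "nat \<Rightarrow> ncpoly \<Rightarrow> (nat \<Rightarrow> real mat) \<Rightarrow> real mat" where
  "ncp_eval n f X = matsum (dim_row (f []) * n) (dim_col (f []) * n)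
     (\<lambda>w. f w \<otimes>\<^sub>K word_eval n X w) (ncp_support f)"


section \<open>Majorization by the highest degree terms\<close>

text \<open>The block row matrix with blocks \<open>C\<^sub>w\<close>, where \<open>w\<close> runs over the words of length \<open>j\<close>
  in the order in which \<open>List.n_lists\<close> enumerates them (the range does not depend on it).\<close>

definition block_row :: "nat \<Rightarrow> nat \<Rightarrow> nat \<Rightarrow> ncpoly \<Rightarrow> real mat" where
  "block_row g \<kappa> j f = (let ws = List.n_lists j [0..<g] in
     mat \<kappa> (length ws * \<kappa>) (\<lambda>(a, b). f (ws ! (b div \<kappa>)) $$ (a, b mod \<kappa>)))"

definition highest_degree_majorizes :: "nat \<Rightarrow> nat \<Rightarrow> ncpoly \<Rightarrow> bool" where
  "highest_degree_majorizes g \<kappa> f \<longleftrightarrow> (\<forall>j. 1 \<le> j \<and> j < ncp_degree f \<longrightarrow>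
     mat_range (block_row g \<kappa> j f) \<subseteq> mat_range (block_row g \<kappa> (ncp_degree f) f))"

end

theory Submission
  imports Defs
begin

text \<open>Write \<open>f = \<Sum>\<^sub>w C\<^sub>w w\<close>. Everything follows from one inequality for the Hankel form of \<open>f\<close>
(\<open>second_order_inequality\<close>): for all families of vectors \<open>\<pi>\<^sub>u \<in> \<real>\<^sup>\<kappa>\<close>, indexed by the nonempty words,
the sum of \<open>\<langle>C\<^sub>w \<pi>\<^sub>v, \<pi>\<^sub>u\<rangle>\<close> over all nonempty \<open>u\<close> and \<open>v\<close>, where \<open>w = u\<^sup>T v\<close>, plus
\<open>1 / \<gamma>\<close> times the squared length of \<open>\<Sum>\<^sub>v C\<^sub>v \<pi>\<^sub>v\<close>, is nonnegative.

Informally, it expresses that \<open>(\<gamma> - f)\<^sup>-\<^sup>1\<close> is a convex function near \<open>0\<close>. To derive it, border a tuple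
\<open>a\<close> by one more row and column, \<open>X\<^sub>s = [[a, s b], [s b\<^sup>T, 0]]\<close>. Conjugating \<open>X\<^sub>s\<close> with a reflection
changes \<open>s\<close> into \<open>-s\<close>, and the midpoint of the two tuples is the direct sum of \<open>a\<close> and \<open>0\<close>. A
block diagonal bound \<open>M\<close> that dominates \<open>f(X\<^sub>s)\<close> also dominates \<open>f(X\<^sub>-\<^sub>s)\<close>, so by convexity of the
sublevel set it dominates \<open>f\<close> at the midpoint. The Schur complement provides an \<open>M\<close> which exceeds
\<open>f(X\<^sub>s)\<close> on the first block only by the square of its off-diagonal part, divided by nearly
\<open>\<gamma>\<close>, and the inequality appears at the order \<open>s\<^sup>2\<close>
(\<open>second_order_inequality_bordered\<close>). The \<open>\<pi>\<^sub>u\<close> that arise this way are the moments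
\<open>\<langle>b\<^sub>j, t(a) \<zeta>\<rangle>\<close> for \<open>u = j t\<close>; if \<open>a\<close> consists of creation plus annihilation operators on a
truncated Fock space and \<open>\<zeta>\<close> is the vacuum, the vectors \<open>t(a) \<zeta>\<close> are linearly independent and
the moments can be prescribed at will (\<open>fock_functional\<close>).

The rest is algebra. If \<open>f\<close> had degree \<open>d \<ge> 3\<close>, majorization would cancel a word of length
\<open>d - 1\<close> against words of length \<open>d\<close> to the first order. The resulting vector is isotropic for the
Hankel form, because it pairs with itself only in lengths above \<open>d\<close>; being isotropic, it is
orthogonal to all letters, and this says that the coefficients of length \<open>d\<close> vanish
(\<open>degree_le_2\<close>). In degree \<open>2\<close> the same cancellation removes the second term of the
inequality for combinations of letters and leaves that the matrix of quadratic
coefficients is positive semidefinite (\<open>quadratic_part_positive\<close>). A Gram factorization of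
that matrix gives the squares.\<close>

section \<open>Evaluation of polynomials on finite index sets\<close>

text \<open>The matrices that the proof needs are indexed by words, by pairs of a word and a coordinate,
and by such a set with one point added. All estimates are therefore made for real functions on
a finite set \<open>S\<close> of any type; only the passage to matrices below numbers the elements of \<open>S\<close>.\<close>

definition quadratic_form :: "'i set \<Rightarrow> ('i \<Rightarrow> 'i \<Rightarrow> real) \<Rightarrow> ('i \<Rightarrow> real) \<Rightarrow> real" where
  "quadratic_form I A v = (\<Sum>i\<in>I. \<Sum>j\<in>I. v i * A i j * v j)"

definition pos_on :: "'i set \<Rightarrow> ('i \<Rightarrow> 'i \<Rightarrow> real) \<Rightarrow> bool" where
  "pos_on I A \<longleftrightarrow> (\<forall>v. (\<exists>i\<in>I. v i \<noteq> 0) \<longrightarrow> 0 < quadratic_form I A v)"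

text \<open>\<open>act S x w v\<close> is \<open>w(X) v\<close>, where \<open>X\<^sub>i\<close> has the entries \<open>x i p q\<close> for \<open>p, q \<in> S\<close>.\<close>

fun act :: "'a set \<Rightarrow> (nat \<Rightarrow> 'a \<Rightarrow> 'a \<Rightarrow> real) \<Rightarrow> nat list \<Rightarrow> ('a \<Rightarrow> real) \<Rightarrow> 'a \<Rightarrow> real" where
  "act S x [] v = v"
| "act S x (i # w) v = (\<lambda>p. \<Sum>r\<in>S. x i p r * act S x w v r)"

abbreviation unit_at :: "'a \<Rightarrow> 'a \<Rightarrow> real" where
  "unit_at q \<equiv> (\<lambda>p. if p = q then 1 else 0)"

text \<open>The entries of \<open>f(X)\<close>: the pair \<open>(k, p)\<close> stands for the row that \<open>C\<^sub>w \<otimes> w(X)\<close>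
derives from row \<open>k\<close> of \<open>C\<^sub>w\<close> and row \<open>p\<close> of \<open>w(X)\<close>.\<close>

definition eval_kernel ::
  "'a set \<Rightarrow> ncpoly \<Rightarrow> (nat \<Rightarrow> 'a \<Rightarrow> 'a \<Rightarrow> real) \<Rightarrow> nat \<times> 'a \<Rightarrow> nat \<times> 'a \<Rightarrow> real" where
  "eval_kernel S f x i j =
     (\<Sum>w\<in>ncp_support f. f w $$ (fst i, fst j) * act S x w (unit_at (snd j)) (snd i))"

definition quasiconvex_below :: "nat \<Rightarrow> nat \<Rightarrow> real \<Rightarrow> ncpoly \<Rightarrow> bool" where
  "quasiconvex_below g \<kappa> \<gamma> f \<longleftrightarrow>
     (\<forall>n\<ge>1. \<forall>M \<in> symmetric_mats (\<kappa> * n). M \<prec>\<^sub>L \<gamma> \<cdot>\<^sub>m 1\<^sub>m (\<kappa> * n) \<longrightarrow>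
        convex_tuples g {X \<in> sym_tuples n g. ncp_eval n f X \<prec>\<^sub>L M})"

lemma act_scale: "act S x w (\<lambda>p. c * v p) p = c * act S x w v p"
  by (induction w arbitrary: p) (auto simp: algebra_simps sum_distrib_left)

lemma act_sum:
  assumes "finite J"
  shows "act S x w (\<lambda>p. \<Sum>j\<in>J. u j p) p = (\<Sum>j\<in>J. act S x w (u j) p)"
proof (induction w arbitrary: p)
  case (Cons i w)
  then show ?case by (simp add: sum_distrib_left) (rule sum.swap)
qed simp

lemma act_cong:
  assumes "\<And>p. p \<in> S \<Longrightarrow> u p = v p" and "p \<in> S"
  shows "act S x w u p = act S x w v p"
  using assms(2) by (induction w arbitrary: p) (auto simp: assms(1) intro!: sum.cong)

lemma act_expand:
  assumes "finite S" "p \<in> S"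
  shows "act S x w v p = (\<Sum>q\<in>S. act S x w (unit_at q) p * v q)"
proof -
  have "act S x w v p = act S x w (\<lambda>p. \<Sum>q\<in>S. v q * unit_at q p) p"
    using assms by (intro act_cong) (auto simp: if_distrib[of "\<lambda>c. _ * c"] sum.delta' cong: if_cong)
  then show ?thesis
    by (simp only: act_sum[OF assms(1)] act_scale mult.commute)
qed

lemma act_append: "act S x (u @ w) v = act S x u (act S x w v)"
  by (induction u) auto

lemma act_adjoint:
  assumes "finite S" "\<And>i p q. x i p q = x i q p"
  shows "(\<Sum>p\<in>S. u p * act S x w v p) = (\<Sum>p\<in>S. act S x (rev w) u p * v p)"
proof (induction w arbitrary: u)
  case (Cons i w)
  have "(\<Sum>p\<in>S. u p * act S x (i # w) v p) = (\<Sum>p\<in>S. \<Sum>r\<in>S. u p * (x i p r * act S x w v r))"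
    by (simp add: sum_distrib_left)
  also have "\<dots> = (\<Sum>r\<in>S. act S x [i] u r * act S x w v r)"
    by (subst sum.swap) (simp add: sum_distrib_left sum_distrib_right assms(2)[of i] mult_ac)
  also have "\<dots> = (\<Sum>p\<in>S. act S x (rev (i # w)) u p * v p)"
    by (simp add: Cons.IH act_append del: act.simps)
  finally show ?case .
qed simp

lemma support_rev:
  assumes "ncp_symmetric f" "w \<in> ncp_support f"
  shows "rev w \<in> ncp_support f"
proof -
  have e: "f w = transpose_mat (f (rev w))" 
    using assms(1) by (metis ncp_symmetric_def ncp_transpose_def)
  show ?thesis
  proof (rule ccontr)
    assume "rev w \<notin> ncp_support f"
    then have "f (rev w) = 0\<^sub>m (dim_row (f (rev w))) (dim_col (f (rev w)))"
      by (simp add: ncp_support_def)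
    then have "f w = 0\<^sub>m (dim_row (f w)) (dim_col (f w))"
      unfolding e by (metis index_transpose_mat(2,3) transpose_mat_def zero_transpose_mat)
    then show False using assms(2) by (simp add: ncp_support_def)
  qed
qed

lemma symmetric_coeff:
  assumes "ncp_symmetric f" "f \<in> ncpolys g \<kappa> \<kappa>" "k < \<kappa>" "l < \<kappa>"
  shows "f (rev w) $$ (k, l) = f w $$ (l, k)"
proof -
  have "f w = transpose_mat (f (rev w))" 
    using assms(1) by (metis ncp_symmetric_def ncp_transpose_def)
  moreover have "f (rev w) \<in> carrier_mat \<kappa> \<kappa>" using assms(2) by (auto simp: ncpolys_def)
  ultimately show ?thesis using assms(3,4) by auto
qed

lemma eval_kernel_sym:
  assumes "ncp_symmetric f" "f \<in> ncpolys g \<kappa> \<kappa>" "finite S" "\<And>i p q. x i p q = x i q p"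
    and "i \<in> {..<\<kappa>} \<times> S" "j \<in> {..<\<kappa>} \<times> S"
  shows "eval_kernel S f x i j = eval_kernel S f x j i"
proof -
  have ad: "act S x (rev w) (unit_at q) p = act S x w (unit_at p) q" if "p \<in> S" "q \<in> S" for p q w
    using act_adjoint[OF assms(3), of x "unit_at q" w "unit_at p"] that assms(3,4)
    by (simp add: if_distrib[of "\<lambda>c. _ * c"] if_distrib[of "\<lambda>c. c * _"] cong: if_cong)
  have "eval_kernel S f x i j = (\<Sum>w\<in>ncp_support f. f (rev w) $$ (fst i, fst j) *
          act S x (rev w) (unit_at (snd j)) (snd i))"
    unfolding eval_kernel_def
    by (rule sum.reindex_bij_witness[of _ rev rev]) (auto simp: support_rev[OF assms(1)])
  also have "\<dots> = eval_kernel S f x j i"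
    unfolding eval_kernel_def using assms(5,6)
    by (intro sum.cong refl) (auto simp: symmetric_coeff[OF assms(1,2)] ad)
  finally show ?thesis .
qed

section \<open>The passage to matrices\<close>

text \<open>An enumeration \<open>h\<close> of \<open>S\<close> turns a function on pairs from \<open>{..<\<kappa>} \<times> S\<close> into a matrix
whose index arithmetic is that of the Kronecker product.\<close>

definition enum_mat ::
  "nat \<Rightarrow> nat \<Rightarrow> (nat \<Rightarrow> 'a) \<Rightarrow> (nat \<times> 'a \<Rightarrow> nat \<times> 'a \<Rightarrow> real) \<Rightarrow> real mat" where
  "enum_mat \<kappa> N h A = mat (\<kappa> * N) (\<kappa> * N)
     (\<lambda>(i, j). A (i div N, h (i mod N)) (j div N, h (j mod N)))"

lemma bij_enum:
  fixes N :: nat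
  assumes "bij_betw h {..<N} S"
  shows "bij_betw (\<lambda>i. (i div N, h (i mod N))) {..<\<kappa> * N} ({..<\<kappa>} \<times> S)"
proof -
  have 1: "bij_betw (\<lambda>i::nat. (i div N, i mod N)) {..<\<kappa> * N} ({..<\<kappa>} \<times> {..<N})"
  proof (rule bij_betw_byWitness[where f' = "\<lambda>(k, r). k * N + r :: nat"])
    show "(\<lambda>(k, r). k * N + r :: nat) ` ({..<\<kappa>} \<times> {..<N}) \<subseteq> {..<\<kappa> * N}"
    proof clarsimp
      fix k r assume "k < \<kappa>" "r < N"
      then have "Suc k * N \<le> \<kappa> * N" by (intro mult_le_mono1) simp
      with \<open>r < N\<close> show "k * N + r < \<kappa> * N" by simp
    qed
    show "(\<lambda>i::nat. (i div N, i mod N)) ` {..<\<kappa> * N} \<subseteq> {..<\<kappa>} \<times> {..<N}"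
      by (auto simp: less_mult_imp_div_less intro!: mod_less_divisor)
        (metis gr0I less_nat_zero_code mult_0_right)
  qed auto
  have "bij_betw (map_prod id h) ({..<\<kappa>} \<times> {..<N}) ({..<\<kappa>} \<times> S)"
    using assms by (intro bij_betw_map_prod) auto
  from bij_betw_trans[OF 1 this] show ?thesis by (simp add: o_def)
qed

lemma enum_mat_symmetric:
  assumes "bij_betw h {..<N} S"
    and "\<And>i j. i \<in> {..<\<kappa>} \<times> S \<Longrightarrow> j \<in> {..<\<kappa>} \<times> S \<Longrightarrow> A i j = A j i"
  shows "enum_mat \<kappa> N h A \<in> symmetric_mats (\<kappa> * N)"
  using bij_betw_apply[OF bij_enum[OF assms(1), of \<kappa>]]
  by (auto simp: enum_mat_def symmetric_mats_def intro!: eq_matI assms(2))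

lemma enum_mat_form:
  assumes "bij_betw h {..<N} S" "v \<in> carrier_vec (\<kappa> * N)"
    and "\<And>i. i < \<kappa> * N \<Longrightarrow> v $ i = u (i div N, h (i mod N))"
  shows "v \<bullet> (enum_mat \<kappa> N h A *\<^sub>v v) = quadratic_form ({..<\<kappa>} \<times> S) A u"
proof -
  let ?e = "\<lambda>i. (i div N, h (i mod N))"
  have "v \<bullet> (enum_mat \<kappa> N h A *\<^sub>v v) = (\<Sum>i<\<kappa> * N. \<Sum>j<\<kappa> * N. u (?e i) * A (?e i) (?e j) * u (?e j))"
    using assms(2)
    by (auto simp: enum_mat_def scalar_prod_def assms(3) lessThan_atLeast0 sum_distrib_left mult_ac
        intro!: sum.cong)
  also have "\<dots> = quadratic_form ({..<\<kappa>} \<times> S) A u"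
    unfolding quadratic_form_def
    by (subst sum.reindex_bij_betw[OF bij_enum[OF assms(1), of \<kappa>], symmetric])+ simp
  finally show ?thesis .
qed

lemma enum_mat_positive_definite:
  fixes A :: "nat \<times> 'a \<Rightarrow> nat \<times> 'a \<Rightarrow> real"
  assumes h: "bij_betw h {..<N} S"
    and "\<And>i j. i \<in> {..<\<kappa>} \<times> S \<Longrightarrow> j \<in> {..<\<kappa>} \<times> S \<Longrightarrow> A i j = A j i"
  shows "positive_definite (enum_mat \<kappa> N h A) \<longleftrightarrow> pos_on ({..<\<kappa>} \<times> S) A"
proof -
  let ?e = "\<lambda>i. (i div N, h (i mod N))"
  note e = bij_enum[OF h, of \<kappa>]
  have dim: "dim_row (enum_mat \<kappa> N h A) = \<kappa> * N" by (simp add: enum_mat_def)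
  have sym: "enum_mat \<kappa> N h A \<in> symmetric_mats (\<kappa> * N)"
    using assms by (rule enum_mat_symmetric)
  show ?thesis
  proof
    assume L: "positive_definite (enum_mat \<kappa> N h A)"
    show "pos_on ({..<\<kappa>} \<times> S) A"
      unfolding pos_on_def
    proof (intro allI impI)
      fix u :: "nat \<times> 'a \<Rightarrow> real"
      assume "\<exists>i\<in>{..<\<kappa>} \<times> S. u i \<noteq> 0"
      then have "\<exists>j\<in>?e ` {..<\<kappa> * N}. u j \<noteq> 0"
        using e by (simp only: bij_betw_imp_surj_on)
      then obtain i where i: "i < \<kappa> * N" "u (?e i) \<noteq> 0"
        by blast
      define v where "v = vec (\<kappa> * N) (\<lambda>i. u (?e i))"
      have v: "v \<in> carrier_vec (\<kappa> * N)" by (simp add: v_def)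
      have "v \<noteq> 0\<^sub>v (\<kappa> * N)"
        using i by (auto simp: v_def vec_eq_iff)
      with L v have "0 < v \<bullet> (enum_mat \<kappa> N h A *\<^sub>v v)"
        by (auto simp: positive_definite_def dim)
      then show "0 < quadratic_form ({..<\<kappa>} \<times> S) A u"
        by (subst (asm) enum_mat_form[OF h v, of u]) (auto simp: v_def)
    qed
  next
    assume R: "pos_on ({..<\<kappa>} \<times> S) A"
    show "positive_definite (enum_mat \<kappa> N h A)"
      unfolding positive_definite_def dim
    proof (intro conjI sym ballI impI)
      fix v :: "real vec" assume v: "v \<in> carrier_vec (\<kappa> * N)" "v \<noteq> 0\<^sub>v (\<kappa> * N)"
      define u where "u = (\<lambda>p. v $ inv_into {..<\<kappa> * N} ?e p)"
      have u: "v $ i = u (?e i)" if "i < \<kappa> * N" for i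
        unfolding u_def using bij_betw_inv_into_left[OF e, of i] that by simp
      obtain i where i: "i < \<kappa> * N" "v $ i \<noteq> 0"
        using v by (auto simp: vec_eq_iff)
      then have "u (?e i) \<noteq> 0" "?e i \<in> {..<\<kappa>} \<times> S"
        using u bij_betw_apply[OF e, of i] by auto
      then have "\<exists>i\<in>{..<\<kappa>} \<times> S. u i \<noteq> 0" by blast
      then have "0 < quadratic_form ({..<\<kappa>} \<times> S) A u"
        using R by (simp add: pos_on_def)
      also have "\<dots> = v \<bullet> (enum_mat \<kappa> N h A *\<^sub>v v)"
        by (rule enum_mat_form[OF h v(1), symmetric]) (rule u)
      finally show "0 < v \<bullet> (enum_mat \<kappa> N h A *\<^sub>v v)" .
    qed
  qed
qed

definition enum_tuple :: "nat \<Rightarrow> nat \<Rightarrow> (nat \<Rightarrow> 'a) \<Rightarrow> (nat \<Rightarrow> 'a \<Rightarrow> 'a \<Rightarrow> real) \<Rightarrow> nat \<Rightarrow> real mat" where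
  "enum_tuple g N h x = (\<lambda>i\<in>{..<g}. mat N N (\<lambda>(r, s). x i (h r) (h s)))"

lemma word_eval_enum_tuple:
  assumes h: "bij_betw h {..<N} S" and "w \<in> lists {..<g}"
  shows "word_eval N (enum_tuple g N h x) w = mat N N (\<lambda>(r, s). act S x w (unit_at (h s)) (h r))"
  using assms(2)
proof (induction w)
  case Nil
  have "h r = h s \<longleftrightarrow> r = s" if "r < N" "s < N" for r s
    using h that by (auto simp: bij_betw_def inj_on_def)
  then show ?case by (auto simp: word_eval_def intro!: eq_matI)
next
  case (Cons i w)
  have "(\<Sum>t = 0..<N. x i (h r) (h t) * act S x w (unit_at (h s)) (h t)) =
        (\<Sum>q\<in>S. x i (h r) q * act S x w (unit_at (h s)) q)" for r s
    using sum.reindex_bij_betw[OF h] by (simp add: lessThan_atLeast0)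
  moreover have "word_eval N (enum_tuple g N h x) (i # w) =
      enum_tuple g N h x i * word_eval N (enum_tuple g N h x) w"
    by (simp add: word_eval_def)
  moreover have "enum_tuple g N h x i = mat N N (\<lambda>(r, s). x i (h r) (h s))"
    using Cons.hyps by (simp add: enum_tuple_def)
  moreover have "word_eval N (enum_tuple g N h x) w = mat N N (\<lambda>(r, s). act S x w (unit_at (h s)) (h r))"
    using Cons by simp
  ultimately show ?case
    by (auto simp: scalar_prod_def intro!: eq_matI)
qed

lemma ncp_eval_enum_tuple:
  assumes h: "bij_betw h {..<N} S" and f: "f \<in> ncpolys g \<kappa> \<kappa>"
  shows "ncp_eval N f (enum_tuple g N h x) = enum_mat \<kappa> N h (eval_kernel S f x)"
proof -
  have fw: "f w \<in> carrier_mat \<kappa> \<kappa>" for w using f by (auto simp: ncpolys_def)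
  have sub: "ncp_support f \<subseteq> lists {..<g}" using f by (auto simp: ncpolys_def)
  have dims: "dim_row (f w) = \<kappa>" "dim_col (f w) = \<kappa>" for w using fw[of w] by auto
  show ?thesis
    unfolding ncp_eval_def matsum_def enum_mat_def dims
  proof (rule cong_mat[OF refl refl], clarsimp)
    fix i j assume ij: "i < \<kappa> * N" "j < \<kappa> * N"
    then have "0 < N" by (metis gr0I less_nat_zero_code mult_0_right)
    then have m: "i mod N < N" "j mod N < N" by auto
    have "(f w \<otimes>\<^sub>K word_eval N (enum_tuple g N h x) w) $$ (i, j) =
       f w $$ (i div N, j div N) * act S x w (unit_at (h (j mod N))) (h (i mod N))"
      if "w \<in> ncp_support f" for w
      using that sub ij m
      by (subst word_eval_enum_tuple[OF h]) (auto simp: kronecker_def dims)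
    then show "(\<Sum>w\<in>ncp_support f. (f w \<otimes>\<^sub>K word_eval N (enum_tuple g N h x) w) $$ (i, j)) =
       eval_kernel S f x (i div N, h (i mod N)) (j div N, h (j mod N))"
      by (simp add: eval_kernel_def)
  qed
qed

text \<open>Convexity of the sublevel sets, applied to a midpoint and translated to functions on finite
index sets. The convexity hypothesis enters the proof only here.\<close>

lemma sublevel_midpoint:
  fixes x y :: "nat \<Rightarrow> 'a \<Rightarrow> 'a \<Rightarrow> real"
  assumes f: "f \<in> ncpolys g \<kappa> \<kappa>" "ncp_symmetric f" and q: "quasiconvex_below g \<kappa> \<gamma> f"
    and S: "finite S" "S \<noteq> {}"
    and x: "\<And>i p q. x i p q = x i q p" and y: "\<And>i p q. y i p q = y i q p"
    and M: "\<And>i j. i \<in> {..<\<kappa>} \<times> S \<Longrightarrow> j \<in> {..<\<kappa>} \<times> S \<Longrightarrow> M i j = M j i"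
    and less: "pos_on ({..<\<kappa>} \<times> S) (\<lambda>i j. (if i = j then \<gamma> else 0) - M i j)"
    and fx: "pos_on ({..<\<kappa>} \<times> S) (\<lambda>i j. M i j - eval_kernel S f x i j)"
    and fy: "pos_on ({..<\<kappa>} \<times> S) (\<lambda>i j. M i j - eval_kernel S f y i j)"
  shows "pos_on ({..<\<kappa>} \<times> S) (\<lambda>i j. M i j - eval_kernel S f (\<lambda>i p q. (x i p q + y i p q) / 2) i j)"
proof -
  define N where "N = card S"
  obtain h where "bij_betw h {0..<N} S" unfolding N_def using ex_bij_betw_nat_finite[OF S(1)] by blast
  then have h: "bij_betw h {..<N} S" by (simp add: lessThan_atLeast0)
  have N: "1 \<le> N" using S by (simp add: N_def Suc_leI card_gt_0_iff)
  have minus: "enum_mat \<kappa> N h A - enum_mat \<kappa> N h B = enum_mat \<kappa> N h (\<lambda>i j. A i j - B i j)" for A B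
    by (auto simp: enum_mat_def intro!: eq_matI)
  have one: "\<gamma> \<cdot>\<^sub>m 1\<^sub>m (\<kappa> * N) = enum_mat \<kappa> N h (\<lambda>i j. if i = j then \<gamma> else 0)"
    using bij_enum[OF h, of \<kappa>]
    by (auto simp: enum_mat_def bij_betw_def inj_on_def intro!: eq_matI)
  have Msym: "enum_mat \<kappa> N h M \<in> symmetric_mats (\<kappa> * N)"
    by (rule enum_mat_symmetric[OF h]) (rule M)
  have Mless: "enum_mat \<kappa> N h M \<prec>\<^sub>L \<gamma> \<cdot>\<^sub>m 1\<^sub>m (\<kappa> * N)"
    unfolding loewner_less_def one minus
    by (rule iffD2[OF enum_mat_positive_definite[OF h] less]) (simp add: M)
  have tup: "enum_tuple g N h z \<in> sym_tuples N g" if "\<And>i p q. z i p q = z i q p" for z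
    using that by (auto simp: sym_tuples_def enum_tuple_def symmetric_mats_def intro!: eq_matI)
  have ev: "ncp_eval N f (enum_tuple g N h z) \<prec>\<^sub>L enum_mat \<kappa> N h M \<longleftrightarrow>
      pos_on ({..<\<kappa>} \<times> S) (\<lambda>i j. M i j - eval_kernel S f z i j)" if "\<And>i p q. z i p q = z i q p" for z
    unfolding loewner_less_def ncp_eval_enum_tuple[OF h f(1)] minus
    using eval_kernel_sym[OF f(2,1) S(1), of z] that M
    by (intro enum_mat_positive_definite[OF h]) metis
  define C where "C = {X \<in> sym_tuples N g. ncp_eval N f X \<prec>\<^sub>L enum_mat \<kappa> N h M}"
  have conv: "convex_tuples g C"
    using q N Msym Mless by (simp add: quasiconvex_below_def C_def)
  have "enum_tuple g N h x \<in> C" "enum_tuple g N h y \<in> C"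
    using tup x y ev[OF x] ev[OF y] fx fy by (auto simp: C_def)
  then have "(\<lambda>i\<in>{..<g}. (1 - 1/2) \<cdot>\<^sub>m enum_tuple g N h x i + (1/2) \<cdot>\<^sub>m enum_tuple g N h y i) \<in> C"
    using conv[unfolded convex_tuples_def, rule_format, of _ _ "1 / 2"] by simp
  also have "(\<lambda>i\<in>{..<g}. (1 - 1/2) \<cdot>\<^sub>m enum_tuple g N h x i + (1/2) \<cdot>\<^sub>m enum_tuple g N h y i) =
     enum_tuple g N h (\<lambda>i p q. (x i p q + y i p q) / 2)"
    by (auto simp: enum_tuple_def restrict_def fun_eq_iff field_simps intro!: eq_matI)
  finally show ?thesis
    using ev[of "\<lambda>i p q. (x i p q + y i p q) / 2"] x y by (simp add: C_def)
qed

section \<open>A majorant from the Schur complement\<close>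

lemma quadratic_form_small:
  fixes e :: real
  assumes "finite I" and "\<And>i j. i \<in> I \<Longrightarrow> j \<in> I \<Longrightarrow> \<bar>A i j\<bar> \<le> e"
  shows "\<bar>quadratic_form I A v\<bar> \<le> e * card I * (\<Sum>i\<in>I. (v i)\<^sup>2)"
proof -
  have entry: "\<bar>v i * A i j * v j\<bar> \<le> e / 2 * ((v i)\<^sup>2 + (v j)\<^sup>2)" if "i \<in> I" "j \<in> I" for i j
  proof -
    have "2 * (\<bar>v i\<bar> * \<bar>v j\<bar>) \<le> (v i)\<^sup>2 + (v j)\<^sup>2"
      using sum_squares_bound[of "\<bar>v i\<bar>" "\<bar>v j\<bar>"] by (simp add: mult.assoc)
    then have "\<bar>A i j\<bar> * (2 * (\<bar>v i\<bar> * \<bar>v j\<bar>)) \<le> e * ((v i)\<^sup>2 + (v j)\<^sup>2)"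
      using assms(2)[OF that] by (intro mult_mono) auto
    then show ?thesis by (simp add: abs_mult mult_ac)
  qed
  have "\<bar>quadratic_form I A v\<bar> \<le> (\<Sum>i\<in>I. \<Sum>j\<in>I. \<bar>v i * A i j * v j\<bar>)"
    unfolding quadratic_form_def by (rule order_trans[OF sum_abs]) (intro sum_mono sum_abs)
  also have "\<dots> \<le> (\<Sum>i\<in>I. \<Sum>j\<in>I. e / 2 * ((v i)\<^sup>2 + (v j)\<^sup>2))"
    by (intro sum_mono entry)
  also have "\<dots> = e / 2 * ((\<Sum>i\<in>I. card I * (v i)\<^sup>2) + card I * (\<Sum>i\<in>I. (v i)\<^sup>2))"
    by (simp only: sum_distrib_left[symmetric] sum.distrib sum_constant)
  also have "\<dots> = e * card I * (\<Sum>i\<in>I. (v i)\<^sup>2)"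
    by (simp add: sum_distrib_left[symmetric])
  finally show ?thesis .
qed

lemma quadratic_form_minus:
  "quadratic_form I (\<lambda>i j. A i j - B i j) v = quadratic_form I A v - quadratic_form I B v"
  by (simp add: quadratic_form_def algebra_simps sum_subtractf)

lemma quadratic_form_add:
  "quadratic_form I (\<lambda>i j. A i j + B i j) v = quadratic_form I A v + quadratic_form I B v"
  by (simp add: quadratic_form_def algebra_simps sum.distrib)

lemma quadratic_form_diag:
  assumes "finite I"
  shows "quadratic_form I (\<lambda>i j. if i = j then c else 0) v = c * (\<Sum>i\<in>I. (v i)\<^sup>2)"
proof -
  have "(\<Sum>j\<in>I. v i * (if i = j then c else 0) * v j) = c * (v i)\<^sup>2" if "i \<in> I" for i
    using assms that by (simp add: if_distrib[of "\<lambda>c. _ * c"] if_distrib[of "\<lambda>c. c * _"] power2_eq_square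
      cong: if_cong)
  then show ?thesis by (simp add: quadratic_form_def sum_distrib_left)
qed

lemma quadratic_form_gram:
  "quadratic_form I (\<lambda>i j. (\<Sum>m\<in>K. \<Phi> m i * \<Phi> m j) / c) v = (\<Sum>m\<in>K. (\<Sum>i\<in>I. \<Phi> m i * v i)\<^sup>2) / c"
proof -
  have "quadratic_form I (\<lambda>i j. (\<Sum>m\<in>K. \<Phi> m i * \<Phi> m j) / c) v =
     (\<Sum>i\<in>I. \<Sum>j\<in>I. \<Sum>m\<in>K. (\<Phi> m i * v i) * (\<Phi> m j * v j) / c)"
    by (simp add: quadratic_form_def sum_distrib_left sum_distrib_right sum_divide_distrib mult_ac)
  also have "\<dots> = (\<Sum>i\<in>I. \<Sum>m\<in>K. \<Sum>j\<in>I. (\<Phi> m i * v i) * (\<Phi> m j * v j) / c)"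
    by (intro sum.cong refl sum.swap)
  also have "\<dots> = (\<Sum>m\<in>K. \<Sum>i\<in>I. \<Sum>j\<in>I. (\<Phi> m i * v i) * (\<Phi> m j * v j) / c)"
    by (rule sum.swap)
  also have "\<dots> = (\<Sum>m\<in>K. (\<Sum>i\<in>I. \<Phi> m i * v i)\<^sup>2 / c)"
    by (simp add: power2_eq_square sum_product sum_divide_distrib)
  finally show ?thesis by (simp add: sum_divide_distrib)
qed

lemma quadratic_form_cong:
  assumes "\<And>i j. i \<in> I \<Longrightarrow> j \<in> I \<Longrightarrow> A i j = B i j"
  shows "quadratic_form I A v = quadratic_form I B v"
  using assms by (simp add: quadratic_form_def)

lemma quadratic_form_split:
  assumes "finite I" "K \<subseteq> I"
  shows "quadratic_form I A v = quadratic_form (I - K) A v + quadratic_form K A v +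
     (\<Sum>m\<in>K. v m * (\<Sum>i\<in>I - K. (A m i + A i m) * v i))"
proof -
  have s: "(\<Sum>i\<in>I. F i) = (\<Sum>i\<in>I - K. F i) + (\<Sum>i\<in>K. F i)" for F :: "'a \<Rightarrow> real"
    using assms by (rule sum.subset_diff[rotated])
  have "(\<Sum>i\<in>I - K. \<Sum>m\<in>K. v i * A i m * v m) = (\<Sum>m\<in>K. \<Sum>i\<in>I - K. v i * A i m * v m)"
    by (rule sum.swap)
  then show ?thesis
    unfolding quadratic_form_def s
    by (simp add: sum.distrib sum_distrib_left algebra_simps)
qed

text \<open>Let \<open>\<Phi>\<close> have blocks \<open>[[A, B], [B\<^sup>T, C]]\<close>, with \<open>K\<close> indexing the second block. The
block diagonal matrix with diagonal blocks \<open>A + B B\<^sup>T / c + \<eta>\<close> and \<open>c'\<close> dominates \<open>\<Phi>\<close>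
as soon as \<open>c' - C\<close> exceeds \<open>c\<close>, because the Schur complement of the difference is then positive.
It does not see the sign of \<open>B\<close>, hence dominates \<open>[[A, -B], [-B\<^sup>T, C]]\<close> as well.\<close>

definition schur_bound ::
  "'i set \<Rightarrow> real \<Rightarrow> real \<Rightarrow> real \<Rightarrow> ('i \<Rightarrow> 'i \<Rightarrow> real) \<Rightarrow> 'i \<Rightarrow> 'i \<Rightarrow> real" where
  "schur_bound K c c' \<eta> \<Phi> i j =
    (if i \<in> K \<and> j \<in> K then (if i = j then c' else 0)
     else if i \<notin> K \<and> j \<notin> K
       then \<Phi> i j + (\<Sum>m\<in>K. \<Phi> m i * \<Phi> m j) / c + (if i = j then \<eta> else 0)
     else 0)"

lemma schur_bound_form:
  assumes "finite I" "K \<subseteq> I"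
  shows "quadratic_form I (schur_bound K c c' \<eta> \<Phi>) v =
    quadratic_form (I - K) \<Phi> v + (\<Sum>m\<in>K. (\<Sum>i\<in>I - K. \<Phi> m i * v i)\<^sup>2) / c
    + \<eta> * (\<Sum>i\<in>I - K. (v i)\<^sup>2) + c' * (\<Sum>i\<in>K. (v i)\<^sup>2)"
proof -
  have fin: "finite (I - K)" "finite K" using assms by (auto intro: finite_subset)
  have "quadratic_form (I - K) (schur_bound K c c' \<eta> \<Phi>) v =
     quadratic_form (I - K) (\<lambda>i j. \<Phi> i j + (\<Sum>m\<in>K. \<Phi> m i * \<Phi> m j) / c + (if i = j then \<eta> else 0)) v"
    by (rule quadratic_form_cong) (auto simp: schur_bound_def)
  moreover have "quadratic_form K (schur_bound K c c' \<eta> \<Phi>) v =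
     quadratic_form K (\<lambda>i j. if i = j then c' else 0) v"
    by (rule quadratic_form_cong) (auto simp: schur_bound_def)
  moreover have "(\<Sum>i\<in>I - K. (schur_bound K c c' \<eta> \<Phi> m i + schur_bound K c c' \<eta> \<Phi> i m) * v i) = 0"
    if "m \<in> K" for m
    using that by (auto simp: schur_bound_def intro!: sum.neutral)
  ultimately show ?thesis
    by (simp add: quadratic_form_split[OF assms] quadratic_form_add quadratic_form_gram
        quadratic_form_diag[OF fin(1)] quadratic_form_diag[OF fin(2)])
qed

lemma sum_squares_pos:
  assumes "finite I" "\<exists>i\<in>I. v i \<noteq> (0::real)"
  shows "0 < (\<Sum>i\<in>I. (v i)\<^sup>2)"
  using assms by (metis sum_pos2 zero_le_power2 zero_less_power2)

text \<open>In the cross terms the square is completed for each index in \<open>K\<close>; the two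
positive margins \<open>\<eta>\<close> and \<open>c' - c - e card K\<close> make the inequality strict.\<close>

lemma schur_bound_dominates:
  fixes \<Phi> :: "'i \<Rightarrow> 'i \<Rightarrow> real" and e :: real
  assumes I: "finite I" "K \<subseteq> I" and sym: "\<And>i j. i \<in> I \<Longrightarrow> j \<in> I \<Longrightarrow> \<Phi> i j = \<Phi> j i"
    and "0 < c" "0 < \<eta>" and small: "\<And>i j. i \<in> K \<Longrightarrow> j \<in> K \<Longrightarrow> \<bar>\<Phi> i j\<bar> \<le> e" "e * card K < c' - c"
  shows "pos_on I (\<lambda>i j. schur_bound K c c' \<eta> \<Phi> i j - \<Phi> i j)"
  unfolding pos_on_def
proof (intro allI impI)
  fix v :: "'i \<Rightarrow> real"
  assume v: "\<exists>i\<in>I. v i \<noteq> 0"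
  have fin: "finite (I - K)" "finite K" using I by (auto intro: finite_subset)
  define C where "C m = (\<Sum>i\<in>I - K. \<Phi> m i * v i)" for m
  define X where "X = (\<Sum>i\<in>I - K. (v i)\<^sup>2)"
  define Y where "Y = (\<Sum>i\<in>K. (v i)\<^sup>2)"
  have "(\<Sum>i\<in>I. (v i)\<^sup>2) = X + Y"
    unfolding X_def Y_def using I by (rule sum.subset_diff[rotated])
  then have XY: "0 < X \<or> 0 < Y" "0 \<le> X" "0 \<le> Y"
    using sum_squares_pos[OF I(1) v] by (auto simp: X_def Y_def intro: sum_nonneg)
  have cross: "(\<Sum>i\<in>I - K. (\<Phi> m i + \<Phi> i m) * v i) = 2 * C m" if "m \<in> K" for m
    using that I sym[of m] unfolding C_def sum_distrib_left by (intro sum.cong) auto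
  have sq: "0 \<le> (C m)\<^sup>2 / c - 2 * (v m * C m) + c * (v m)\<^sup>2" for m
  proof -
    have "(C m)\<^sup>2 / c - 2 * (v m * C m) + c * (v m)\<^sup>2 = (C m - c * v m)\<^sup>2 / c"
      using \<open>0 < c\<close> by (simp add: power2_eq_square field_simps)
    then show ?thesis using \<open>0 < c\<close> by simp
  qed
  have "quadratic_form I (\<lambda>i j. schur_bound K c c' \<eta> \<Phi> i j - \<Phi> i j) v =
     (\<Sum>m\<in>K. (C m)\<^sup>2) / c + \<eta> * X + c' * Y - quadratic_form K \<Phi> v - (\<Sum>m\<in>K. v m * (2 * C m))"
    unfolding quadratic_form_minus schur_bound_form[OF I] quadratic_form_split[OF I, of \<Phi>]
    by (simp add: cross C_def X_def Y_def)
  also have "\<dots> = (\<Sum>m\<in>K. (C m)\<^sup>2 / c - 2 * (v m * C m) + c * (v m)\<^sup>2) + \<eta> * X + ((c' - c) * Y - quadratic_form K \<Phi> v)"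
    by (simp add: sum.distrib sum_subtractf sum_divide_distrib sum_distrib_left Y_def algebra_simps)
  also have "\<dots> > 0"
  proof -
    have "quadratic_form K \<Phi> v \<le> e * card K * Y"
      using quadratic_form_small[where A = \<Phi> and v = v, OF fin(2) small(1)] by (simp add: Y_def)
    moreover have "e * card K * Y \<le> (c' - c) * Y" "0 < Y \<Longrightarrow> e * card K * Y < (c' - c) * Y"
      using small(2) XY by (auto intro: mult_right_mono)
    moreover have "0 \<le> \<eta> * X" "0 < X \<Longrightarrow> 0 < \<eta> * X" using \<open>0 < \<eta>\<close> XY by auto
    moreover have "0 \<le> (\<Sum>m\<in>K. (C m)\<^sup>2 / c - 2 * (v m * C m) + c * (v m)\<^sup>2)"
      by (intro sum_nonneg sq)
    ultimately show ?thesis using XY(1) by linarith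
  qed
  finally show "0 < quadratic_form I (\<lambda>i j. schur_bound K c c' \<eta> \<Phi> i j - \<Phi> i j) v" .
qed

text \<open>If all entries of \<open>\<Phi>\<close> are small, the first block of the majorant is small too, so the
majorant stays below \<open>\<gamma>\<close>: it is one of the bounds for which the sublevel set is convex.\<close>

lemma schur_bound_less:
  fixes \<Phi> :: "'i \<Rightarrow> 'i \<Rightarrow> real" and e :: real
  assumes I: "finite I" "K \<subseteq> I" and e: "0 < \<epsilon>" "\<epsilon> \<le> \<gamma> / 4" "\<eta> \<le> \<gamma> / 4"
    and small: "\<And>i j. i \<in> I \<Longrightarrow> j \<in> I \<Longrightarrow> \<bar>\<Phi> i j\<bar> \<le> e" "0 \<le> e" "e * card I \<le> \<epsilon> / 2"
  shows "pos_on I (\<lambda>i j. (if i = j then \<gamma> else 0) - schur_bound K (\<gamma> - 2 * \<epsilon>) (\<gamma> - \<epsilon>) \<eta> \<Phi> i j)"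
  unfolding pos_on_def
proof (intro allI impI)
  fix v :: "'i \<Rightarrow> real"
  assume v: "\<exists>i\<in>I. v i \<noteq> 0"
  have fin: "finite (I - K)" "finite K" using I by (auto intro: finite_subset)
  define c where "c = \<gamma> - 2 * \<epsilon>"
  have c: "\<gamma> / 2 \<le> c" "0 < c" "0 < \<gamma>" using e by (auto simp: c_def)
  define X where "X = (\<Sum>i\<in>I - K. (v i)\<^sup>2)"
  define Y where "Y = (\<Sum>i\<in>K. (v i)\<^sup>2)"
  have XY': "(\<Sum>i\<in>I. (v i)\<^sup>2) = X + Y"
    unfolding X_def Y_def using I by (rule sum.subset_diff[rotated])
  then have XY: "0 < X \<or> 0 < Y" "0 \<le> X" "0 \<le> Y"
    using sum_squares_pos[OF I(1) v] by (auto simp: X_def Y_def intro: sum_nonneg)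
  define E where "E i j = \<Phi> i j + (\<Sum>m\<in>K. \<Phi> m i * \<Phi> m j) / c" for i j
  \<comment> \<open>Since \<open>e card I \<le> \<epsilon> / 2 \<le> c / 4\<close>, the quadratic correction is at most a quarter of \<open>e\<close>.\<close>
  have E: "\<bar>E i j\<bar> \<le> 5/4 * e" if "i \<in> I - K" "j \<in> I - K" for i j
  proof -
    have "\<bar>\<Sum>m\<in>K. \<Phi> m i * \<Phi> m j\<bar> \<le> (\<Sum>m\<in>K. e * e)"
      using small(1) I that small(2)
      by (intro order_trans[OF sum_abs] sum_mono) (auto simp: abs_mult intro!: mult_mono)
    also have "\<dots> = e * card K * e" by simp
    also have "\<dots> \<le> e * card I * e"
      using card_mono[OF I] small(2) by (intro mult_right_mono mult_left_mono) auto
    also have "\<dots> \<le> \<epsilon> / 2 * e" using small by (intro mult_right_mono) auto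
    also have "\<dots> \<le> c / 4 * e" using e c small by (intro mult_right_mono) auto
    finally have "\<bar>\<Sum>m\<in>K. \<Phi> m i * \<Phi> m j\<bar> / c \<le> e / 4" using c by (simp add: field_simps)
    then have "\<bar>(\<Sum>m\<in>K. \<Phi> m i * \<Phi> m j) / c\<bar> \<le> e / 4" using c by simp
    moreover have "\<bar>\<Phi> i j\<bar> \<le> e" using small(1) that by auto
    ultimately show ?thesis unfolding E_def by linarith
  qed
  have "quadratic_form (I - K) E v \<le> 5/4 * e * card (I - K) * X"
    using quadratic_form_small[where A = E and v = v, OF fin(1) E] by (simp add: X_def)
  also have "\<dots> \<le> 5/4 * (\<epsilon> / 2) * X"
  proof -
    have "e * card (I - K) \<le> e * card I"
      using small(2) by (intro mult_left_mono) (auto intro!: card_mono I)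
    then have "e * card (I - K) \<le> \<epsilon> / 2" using small(3) by simp
    then have "5/4 * (e * card (I - K)) * X \<le> 5/4 * (\<epsilon> / 2) * X" using XY by (intro mult_right_mono) auto
    then show ?thesis by (simp add: mult.assoc)
  qed
  also have "\<dots> \<le> \<gamma> / 4 * X" using XY e by (intro mult_right_mono) auto
  finally have EX: "quadratic_form (I - K) E v \<le> \<gamma> / 4 * X" .
  have "quadratic_form (I - K) E v =
     quadratic_form (I - K) \<Phi> v + (\<Sum>m\<in>K. (\<Sum>i\<in>I - K. \<Phi> m i * v i)\<^sup>2) / c"
    unfolding E_def quadratic_form_add quadratic_form_gram ..
  then have "quadratic_form I (\<lambda>i j. (if i = j then \<gamma> else 0) - schur_bound K c (\<gamma> - \<epsilon>) \<eta> \<Phi> i j) v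
     = \<gamma> * (X + Y) - (quadratic_form (I - K) E v + \<eta> * X + (\<gamma> - \<epsilon>) * Y)"
    unfolding quadratic_form_minus schur_bound_form[OF I] quadratic_form_diag[OF I(1)] XY'
    by (simp add: X_def Y_def)
  also have "\<dots> > 0"
  proof -
    have "\<eta> * X \<le> \<gamma> / 4 * X" using e XY by (intro mult_right_mono) auto
    with EX have "quadratic_form (I - K) E v + \<eta> * X \<le> \<gamma> / 2 * X" by simp
    moreover have "0 < \<gamma> / 2 * X + \<epsilon> * Y" using XY e c by (auto simp: add_pos_nonneg add_nonneg_pos)
    ultimately show ?thesis by (simp add: algebra_simps)
  qed
  finally show "0 < quadratic_form I (\<lambda>i j. (if i = j then \<gamma> else 0) -
      schur_bound K (\<gamma> - 2 * \<epsilon>) (\<gamma> - \<epsilon>) \<eta> \<Phi> i j) v" unfolding c_def .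
qed

lemma schur_bound_flip:
  assumes "K \<subseteq> I" "\<And>i j. i \<in> I \<Longrightarrow> j \<in> I \<Longrightarrow> \<Psi> i j = (if i \<in> K \<longleftrightarrow> j \<in> K then \<Phi> i j else - \<Phi> i j)"
    "i \<in> I" "j \<in> I"
  shows "schur_bound K c c' \<eta> \<Psi> i j = schur_bound K c c' \<eta> \<Phi> i j"
proof -
  have "(\<Sum>m\<in>K. \<Psi> m i * \<Psi> m j) = (\<Sum>m\<in>K. \<Phi> m i * \<Phi> m j)" if "i \<notin> K" "j \<notin> K"
    using that assms by (intro sum.cong) (auto simp: subset_iff)
  then show ?thesis using assms by (auto simp: schur_bound_def)
qed

section \<open>Second variation of a bordered tuple\<close>

text \<open>The tuple \<open>a\<close> on \<open>T\<close> is bordered by one further point \<open>None\<close>: the vectors \<open>s b\<^sub>i\<close> link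
\<open>T\<close> to it. Replacing \<open>s\<close> by \<open>-s\<close> is conjugation with the reflection that changes
the sign at \<open>None\<close>, and the midpoint of the two bordered tuples is the direct sum of \<open>a\<close> and \<open>0\<close>.\<close>

abbreviation bordered :: "'a set \<Rightarrow> 'a option set" where
  "bordered T \<equiv> insert None (Some ` T)"

definition border ::
  "(nat \<Rightarrow> 'a \<Rightarrow> 'a \<Rightarrow> real) \<Rightarrow> (nat \<Rightarrow> 'a \<Rightarrow> real) \<Rightarrow> real \<Rightarrow> nat \<Rightarrow> 'a option \<Rightarrow> 'a option \<Rightarrow> real" where
  "border a b s i P Q = (case (P, Q) of
     (Some p, Some q) \<Rightarrow> a i p q
   | (Some p, None) \<Rightarrow> s * b i p
   | (None, Some q) \<Rightarrow> s * b i q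
   | (None, None) \<Rightarrow> 0)"

lemma border_simps [simp]:
  "border a b s i (Some p) (Some q) = a i p q"
  "border a b s i (Some p) None = s * b i p"
  "border a b s i None (Some q) = s * b i q"
  "border a b s i None None = 0"
  by (simp_all add: border_def)

lemma sum_bordered:
  fixes F :: "'a option \<Rightarrow> real"
  shows "finite T \<Longrightarrow> (\<Sum>P\<in>bordered T. F P) = F None + (\<Sum>p\<in>T. F (Some p))"
  by (simp add: sum.reindex image_iff)

lemma border_sym:
  assumes "\<And>i p q. a i p q = a i q p"
  shows "border a b s i P Q = border a b s i Q P"
  using assms by (auto simp: border_def split: option.splits)

text \<open>The component at \<open>None\<close> of \<open>w(X)\<zeta>\<close> is \<open>s\<close> times this number, up to higher order in \<open>s\<close>:
the first letter of \<open>w\<close> has to cross from \<open>T\<close> to \<open>None\<close>, and all the others stay in \<open>T\<close>.\<close>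

fun moment ::
  "'a set \<Rightarrow> (nat \<Rightarrow> 'a \<Rightarrow> 'a \<Rightarrow> real) \<Rightarrow> (nat \<Rightarrow> 'a \<Rightarrow> real) \<Rightarrow> ('a \<Rightarrow> real) \<Rightarrow> nat list \<Rightarrow> real" where
  "moment T a b \<zeta> [] = 0"
| "moment T a b \<zeta> (j # t) = (\<Sum>p\<in>T. b j p * act T a t \<zeta> p)"

text \<open>The coefficient of \<open>s\<^sup>2\<close> in the \<open>T\<close>-component of \<open>w(X)\<zeta>\<close>: a path that leaves \<open>T\<close>
must come back with the next letter, as the bordered tuple is \<open>0\<close> at \<open>(None, None)\<close>.\<close>

fun second_variation ::
  "'a set \<Rightarrow> (nat \<Rightarrow> 'a \<Rightarrow> 'a \<Rightarrow> real) \<Rightarrow> (nat \<Rightarrow> 'a \<Rightarrow> real) \<Rightarrow> ('a \<Rightarrow> real) \<Rightarrow> nat list \<Rightarrow> 'a \<Rightarrow> real" where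
  "second_variation T a b \<zeta> [] p = 0"
| "second_variation T a b \<zeta> (i # w) p =
     (\<Sum>r\<in>T. a i p r * second_variation T a b \<zeta> w r) + b i p * moment T a b \<zeta> w"

text \<open>Dividing the component at \<open>None\<close> by \<open>s\<close> and the change of the component in \<open>T\<close> by
\<open>s\<^sup>2\<close> gives quantities whose recursions along the word have a limit as \<open>s \<rightarrow> 0\<close>.\<close>

lemma act_border_limits:
  fixes T :: "'a set" and a :: "nat \<Rightarrow> 'a \<Rightarrow> 'a \<Rightarrow> real" and b :: "nat \<Rightarrow> 'a \<Rightarrow> real" and \<zeta> :: "'a \<Rightarrow> real"
  assumes T: "finite T"
  defines "A \<equiv> \<lambda>s w. act (bordered T) (border a b s) w (case_option 0 \<zeta>)"
  shows "((\<lambda>s. A s w (Some p)) \<longlongrightarrow> act T a w \<zeta> p) (at 0)"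
    and "((\<lambda>s. A s w None / s) \<longlongrightarrow> moment T a b \<zeta> w) (at 0)"
    and "((\<lambda>s. (A s w (Some p) - act T a w \<zeta> p) / s\<^sup>2) \<longlongrightarrow> second_variation T a b \<zeta> w p) (at 0)"
proof -
  have nz: "\<forall>\<^sub>F s in at (0::real). s \<noteq> 0" by (simp add: eventually_at_filter)
  have Some: "A s (i # w) (Some p) = s * b i p * A s w None + (\<Sum>r\<in>T. a i p r * A s w (Some r))" for s i w p
    by (simp add: A_def sum_bordered[OF T])
  have None: "A s (i # w) None = s * (\<Sum>r\<in>T. b i r * A s w (Some r))" for s i w
    by (simp add: A_def sum_bordered[OF T] sum_distrib_left mult_ac)
  have "\<forall>p. ((\<lambda>s. A s w (Some p)) \<longlongrightarrow> act T a w \<zeta> p) (at 0) \<and>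
        ((\<lambda>s. A s w None / s) \<longlongrightarrow> moment T a b \<zeta> w) (at 0) \<and>
        ((\<lambda>s. (A s w (Some p) - act T a w \<zeta> p) / s\<^sup>2) \<longlongrightarrow> second_variation T a b \<zeta> w p) (at 0)"
  proof (induction w)
    case Nil
    show ?case by (simp add: A_def)
  next
    case (Cons i w)
    then have IH: "\<And>p. ((\<lambda>s. A s w (Some p)) \<longlongrightarrow> act T a w \<zeta> p) (at 0)"
        "((\<lambda>s. A s w None / s) \<longlongrightarrow> moment T a b \<zeta> w) (at 0)"
        "\<And>p. ((\<lambda>s. (A s w (Some p) - act T a w \<zeta> p) / s\<^sup>2) \<longlongrightarrow> second_variation T a b \<zeta> w p) (at 0)"
      by blast+
    have s2: "((\<lambda>s::real. s\<^sup>2) \<longlongrightarrow> 0) (at 0)"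
      by (rule tendsto_eq_intros refl | simp)+
    show ?case
    proof (intro allI conjI)
      fix p
      have "((\<lambda>s. s\<^sup>2 * b i p * (A s w None / s) + (\<Sum>r\<in>T. a i p r * A s w (Some r))) \<longlongrightarrow>
          0 * b i p * moment T a b \<zeta> w + (\<Sum>r\<in>T. a i p r * act T a w \<zeta> r)) (at 0)"
        by (intro tendsto_intros IH s2)
      then have "((\<lambda>s. s\<^sup>2 * b i p * (A s w None / s) + (\<Sum>r\<in>T. a i p r * A s w (Some r))) \<longlongrightarrow>
          act T a (i # w) \<zeta> p) (at 0)" by simp
      then show "((\<lambda>s. A s (i # w) (Some p)) \<longlongrightarrow> act T a (i # w) \<zeta> p) (at 0)"
        by (rule Lim_transform_eventually[OF _ eventually_mono[OF nz]])
          (auto simp: Some power2_eq_square)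
      have "((\<lambda>s. \<Sum>r\<in>T. b i r * A s w (Some r)) \<longlongrightarrow> (\<Sum>r\<in>T. b i r * act T a w \<zeta> r)) (at 0)"
        by (intro tendsto_intros IH)
      then show "((\<lambda>s. A s (i # w) None / s) \<longlongrightarrow> moment T a b \<zeta> (i # w)) (at 0)"
        unfolding moment.simps
        by (rule Lim_transform_eventually[OF _ eventually_mono[OF nz]]) (auto simp: None)
      have "((\<lambda>s. (\<Sum>r\<in>T. a i p r * ((A s w (Some r) - act T a w \<zeta> r) / s\<^sup>2)) + b i p * (A s w None / s))
          \<longlongrightarrow> second_variation T a b \<zeta> (i # w) p) (at 0)"
        unfolding second_variation.simps by (intro tendsto_intros IH)
      moreover have "(\<Sum>r\<in>T. a i p r * ((A s w (Some r) - act T a w \<zeta> r) / s\<^sup>2)) + b i p * (A s w None / s) =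
          (A s (i # w) (Some p) - act T a (i # w) \<zeta> p) / s\<^sup>2" if "s \<noteq> 0" for s
        using that by (simp add: Some diff_divide_distrib add_divide_distrib right_diff_distrib
            sum_subtractf sum_divide_distrib power2_eq_square)
      ultimately show "((\<lambda>s. (A s (i # w) (Some p) - act T a (i # w) \<zeta> p) / s\<^sup>2)
          \<longlongrightarrow> second_variation T a b \<zeta> (i # w) p) (at 0)"
        by (rule Lim_transform_eventually[OF _ eventually_mono[OF nz]])
    qed
  qed
  then show "((\<lambda>s. A s w (Some p)) \<longlongrightarrow> act T a w \<zeta> p) (at 0)"
    and "((\<lambda>s. A s w None / s) \<longlongrightarrow> moment T a b \<zeta> w) (at 0)"
    and "((\<lambda>s. (A s w (Some p) - act T a w \<zeta> p) / s\<^sup>2) \<longlongrightarrow> second_variation T a b \<zeta> w p) (at 0)"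
    by blast+
qed

lemma act_border_continuous:
  assumes "finite T"
  shows "((\<lambda>s. act (bordered T) (border a b s) w v P) \<longlongrightarrow> act (bordered T) (border a b 0) w v P) (at 0)"
proof (induction w arbitrary: P)
  case (Cons i w)
  have "((\<lambda>s. border a b s i P Q) \<longlongrightarrow> border a b 0 i P Q) (at 0)" for P Q
    by (cases P; cases Q) (auto intro!: tendsto_eq_intros)
  then show ?case unfolding act.simps by (intro tendsto_intros Cons.IH)
qed simp

lemma act_border_zero:
  assumes "finite T"
  shows "act (bordered T) (border a b 0) w v (Some p) = act T a w (\<lambda>p. v (Some p)) p"
    and "w \<noteq> [] \<Longrightarrow> act (bordered T) (border a b 0) w v None = 0"
proof -
  show "act (bordered T) (border a b 0) w v (Some p) = act T a w (\<lambda>p. v (Some p)) p"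
    by (induction w arbitrary: p) (auto simp: sum_bordered[OF assms])
  show "w \<noteq> [] \<Longrightarrow> act (bordered T) (border a b 0) w v None = 0"
    by (cases w) (auto simp: sum_bordered[OF assms])
qed

lemma act_border_flip:
  fixes T :: "'a set"
  assumes "finite T"
  defines "\<sigma> \<equiv> (\<lambda>P :: 'a option. if P = None then - 1 else 1 :: real)"
  shows "act (bordered T) (border a b (- s)) w v P =
    \<sigma> P * act (bordered T) (border a b s) w (\<lambda>Q. \<sigma> Q * v Q) P"
proof (induction w arbitrary: P)
  case Nil
  show ?case by (simp add: \<sigma>_def)
next
  case (Cons i w)
  have "border a b (- s) i P Q * \<sigma> Q = \<sigma> P * border a b s i P Q" for Q
    by (cases P; cases Q) (auto simp: \<sigma>_def)
  then show ?case unfolding act.simps Cons.IH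
    by (simp only: sum_distrib_left mult.assoc[symmetric])
qed

text \<open>Each place \<open>m\<close> at which the path visits \<open>None\<close> cuts the word in two, and by symmetry of \<open>a\<close>
the left part, read backwards, contributes a moment of its own. A cut at the very end contributes
nothing, as the moment of the empty word is \<open>0\<close>. The word \<open>r\<close> collects the letters passed on to the left factor during the induction.\<close>

lemma act_second_variation:
  assumes T: "finite T" and sym: "\<And>i p q. a i p q = a i q p"
  shows "(\<Sum>p\<in>T. act T a r \<xi> p * second_variation T a b \<zeta> w p) =
     (\<Sum>m\<in>{1..length w}. moment T a b \<xi> (rev (take m w) @ r) * moment T a b \<zeta> (drop m w))"
proof (induction w arbitrary: r)
  case (Cons i w)
  have "(\<Sum>p\<in>T. act T a r \<xi> p * (\<Sum>q\<in>T. a i p q * second_variation T a b \<zeta> w q)) =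
        (\<Sum>q\<in>T. act T a (i # r) \<xi> q * second_variation T a b \<zeta> w q)"
    unfolding sum_distrib_left act.simps sum_distrib_right
    by (subst sum.swap) (simp add: sym[of i] mult_ac)
  moreover have "(\<Sum>p\<in>T. act T a r \<xi> p * (b i p * moment T a b \<zeta> w)) =
        moment T a b \<xi> (i # r) * moment T a b \<zeta> w"
    by (simp add: sum_distrib_left sum_distrib_right mult_ac)
  moreover have "(\<Sum>m\<in>{1..length (i # w)}.
        moment T a b \<xi> (rev (take m (i # w)) @ r) * moment T a b \<zeta> (drop m (i # w))) =
      moment T a b \<xi> (i # r) * moment T a b \<zeta> w +
      (\<Sum>m\<in>{1..length w}. moment T a b \<xi> (rev (take m w) @ i # r) * moment T a b \<zeta> (drop m w))"
  proof -
    have shift: "(\<Sum>m\<in>{1..Suc n}. G m) = G 1 + (\<Sum>m\<in>{1..n}. G (Suc m))" for G :: "nat \<Rightarrow> real" and n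
      using sum.shift_bounds_cl_Suc_ivl[of G 1 n] by (subst sum.atLeast_Suc_atMost) auto
    show ?thesis unfolding length_Cons shift by simp
  qed
  ultimately show ?case using Cons.IH[of "i # r"] by (simp add: distrib_left sum.distrib)
qed simp

lemma eval_kernel_apply:
  assumes "finite S" "P \<in> S"
  shows "(\<Sum>j\<in>{..<\<kappa>} \<times> S. eval_kernel S f x (k, P) j * z j) =
     (\<Sum>w\<in>ncp_support f. \<Sum>l<\<kappa>. f w $$ (k, l) * act S x w (\<lambda>Q. z (l, Q)) P)"
proof -
  have "(\<Sum>j\<in>{..<\<kappa>} \<times> S. eval_kernel S f x (k, P) j * z j) =
    (\<Sum>l<\<kappa>. \<Sum>Q\<in>S. \<Sum>w\<in>ncp_support f. f w $$ (k, l) * (act S x w (unit_at Q) P * z (l, Q)))"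
    unfolding sum.cartesian_product' by (simp add: eval_kernel_def sum_distrib_left sum_distrib_right mult_ac)
  also have "\<dots> = (\<Sum>l<\<kappa>. \<Sum>w\<in>ncp_support f. f w $$ (k, l) * act S x w (\<lambda>Q. z (l, Q)) P)"
    by (subst sum.swap) (simp add: sum_distrib_left[symmetric] act_expand[OF assms, of x _ "\<lambda>Q. z (_, Q)"])
  also have "\<dots> = (\<Sum>w\<in>ncp_support f. \<Sum>l<\<kappa>. f w $$ (k, l) * act S x w (\<lambda>Q. z (l, Q)) P)"
    by (rule sum.swap)
  finally show ?thesis .
qed

lemma eval_kernel_form:
  assumes "finite S"
  shows "quadratic_form ({..<\<kappa>} \<times> S) (eval_kernel S f x) z =
     (\<Sum>w\<in>ncp_support f. \<Sum>k<\<kappa>. \<Sum>l<\<kappa>. f w $$ (k, l) *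
        (\<Sum>P\<in>S. z (k, P) * act S x w (\<lambda>Q. z (l, Q)) P))"
proof -
  have "quadratic_form ({..<\<kappa>} \<times> S) (eval_kernel S f x) z =
     (\<Sum>k<\<kappa>. \<Sum>P\<in>S. z (k, P) * (\<Sum>j\<in>{..<\<kappa>} \<times> S. eval_kernel S f x (k, P) j * z j))"
    unfolding quadratic_form_def sum.cartesian_product'[of _ "{..<\<kappa>}" S]
    by (simp add: sum_distrib_left mult_ac)
  also have "\<dots> = (\<Sum>k<\<kappa>. \<Sum>P\<in>S. \<Sum>w\<in>ncp_support f. \<Sum>l<\<kappa>.
       f w $$ (k, l) * (z (k, P) * act S x w (\<lambda>Q. z (l, Q)) P))"
    by (intro sum.cong refl, subst eval_kernel_apply[OF assms]) (auto simp: sum_distrib_left mult_ac)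
  also have "\<dots> = (\<Sum>k<\<kappa>. \<Sum>w\<in>ncp_support f. \<Sum>P\<in>S. \<Sum>l<\<kappa>.
       f w $$ (k, l) * (z (k, P) * act S x w (\<lambda>Q. z (l, Q)) P))"
    by (intro sum.cong refl sum.swap)
  also have "\<dots> = (\<Sum>k<\<kappa>. \<Sum>w\<in>ncp_support f. \<Sum>l<\<kappa>. \<Sum>P\<in>S.
       f w $$ (k, l) * (z (k, P) * act S x w (\<lambda>Q. z (l, Q)) P))"
    by (intro sum.cong refl sum.swap)
  also have "\<dots> = (\<Sum>w\<in>ncp_support f. \<Sum>k<\<kappa>. \<Sum>l<\<kappa>. \<Sum>P\<in>S.
       f w $$ (k, l) * (z (k, P) * act S x w (\<lambda>Q. z (l, Q)) P))"
    by (rule sum.swap)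
  finally show ?thesis by (simp add: sum_distrib_left)
qed

text \<open>For \<open>\<pi> k [] = 0\<close> this is \<open>\<Sum>\<^sub>u\<^sub>,\<^sub>v \<pi>\<^sub>u\<^sup>T C \<pi>\<^sub>v\<close> with \<open>C\<close> the coefficient of \<open>u\<^sup>T v\<close>, the
Hankel form of \<open>f\<close>, written as a sum over the words \<open>w = u\<^sup>T v\<close> of the support and their cuts.\<close>

definition second_order_form :: "nat \<Rightarrow> ncpoly \<Rightarrow> (nat \<Rightarrow> nat list \<Rightarrow> real) \<Rightarrow> real" where
  "second_order_form \<kappa> f \<pi> = (\<Sum>w\<in>ncp_support f. \<Sum>k<\<kappa>. \<Sum>l<\<kappa>. f w $$ (k, l) *
     (\<Sum>m\<in>{1..length w}. \<pi> k (rev (take m w)) * \<pi> l (drop m w)))"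

text \<open>The squared length of the vector \<open>\<Sum>\<^sub>w C\<^sub>w \<pi>\<^sub>w\<close> in \<open>\<real>\<^sup>\<kappa>\<close>.\<close>

definition first_order_norm :: "nat \<Rightarrow> ncpoly \<Rightarrow> (nat \<Rightarrow> nat list \<Rightarrow> real) \<Rightarrow> real" where
  "first_order_norm \<kappa> f \<pi> = (\<Sum>k<\<kappa>. (\<Sum>w\<in>ncp_support f. \<Sum>l<\<kappa>. f w $$ (k, l) * \<pi> l w)\<^sup>2)"

text \<open>The bordered tuples for \<open>s\<close> and \<open>-s\<close> both satisfy \<open>f(X) \<prec> M\<close> for the Schur majorant
\<open>M\<close>, so their midpoint does. Testing this on a vector \<open>z\<close> that lives on \<open>T\<close> compares
\<open>\<langle>f(a) z, z\<rangle>\<close> with \<open>\<langle>f(X) z, z\<rangle> + |B\<^sup>T z|\<^sup>2 / c\<close>. Both sides agree at \<open>s = 0\<close>; the claim is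
what remains after division by \<open>s\<^sup>2\<close> in the limit.\<close>

lemma second_order_inequality_bordered:
  fixes T :: "'a set" and e :: real
  assumes f: "f \<in> ncpolys g \<kappa> \<kappa>" "ncp_symmetric f" and q: "quasiconvex_below g \<kappa> \<gamma> f"
    and T: "finite T" and a: "\<And>i p q. a i p q = a i q p"
    and eps: "0 < \<epsilon>" "\<epsilon> \<le> \<gamma> / 4"
    and small: "0 < e" "e * card ({..<\<kappa>} \<times> bordered T) \<le> \<epsilon> / 2"
      "\<And>i j. i \<in> {..<\<kappa>} \<times> bordered T \<Longrightarrow> j \<in> {..<\<kappa>} \<times> bordered T \<Longrightarrow>
        \<bar>eval_kernel (bordered T) f (border a b 0) i j\<bar> < e"
  shows "0 \<le> second_order_form \<kappa> f (\<lambda>k. moment T a b (\<zeta> k))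
     + first_order_norm \<kappa> f (\<lambda>k. moment T a b (\<zeta> k)) / (\<gamma> - 2 * \<epsilon>)
     + \<epsilon> * (\<Sum>k<\<kappa>. \<Sum>p\<in>T. (\<zeta> k p)\<^sup>2)"
proof -
  define S where "S = bordered T"
  define I where "I = {..<\<kappa>} \<times> S"
  define K where "K = {..<\<kappa>} \<times> {None :: 'a option}"
  define c where "c = \<gamma> - 2 * \<epsilon>"
  define \<Phi> where "\<Phi> s = eval_kernel S f (border a b s)" for s
  define z where "z = (\<lambda>(k, P). case_option 0 (\<zeta> k) P)"
  have S: "finite S" "S \<noteq> {}" and I: "finite I" "K \<subseteq> I" "finite K"
    using T by (auto simp: S_def I_def K_def)
  have c: "0 < c" using eps by (simp add: c_def)
  have z_eq: "(\<lambda>Q. z (k, Q)) = case_option 0 (\<zeta> k)" for k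
    by (simp add: z_def)
  have zK: "z i = 0" if "i \<in> K" for i using that by (auto simp: z_def K_def)
  have sym: "\<Phi> s i j = \<Phi> s j i" if "i \<in> I" "j \<in> I" for s i j
    using that unfolding \<Phi>_def I_def
    by (intro eval_kernel_sym[OF f(2,1) S(1)] border_sym a)
  have zsum: "(\<Sum>i\<in>I - K. F i * z i) = (\<Sum>i\<in>I. F i * z i)" for F
    using I zK by (intro sum.mono_neutral_left) auto
  have zsq: "(\<Sum>i\<in>I - K. (z i)\<^sup>2) = (\<Sum>k<\<kappa>. \<Sum>p\<in>T. (\<zeta> k p)\<^sup>2)"
  proof -
    have "(\<Sum>i\<in>I - K. (z i)\<^sup>2) = (\<Sum>i\<in>I. (z i)\<^sup>2)"
      using I zK by (intro sum.mono_neutral_left) auto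
    then show ?thesis
      unfolding I_def sum.cartesian_product' by (simp add: S_def sum_bordered[OF T] z_def)
  qed
  have zform: "quadratic_form (I - K) (\<Phi> s) z = quadratic_form I (\<Phi> s) z" for s
    unfolding quadratic_form_split[OF I(1,2), of "\<Phi> s"]
    by (simp add: quadratic_form_def zK)
  define Q where "Q s = quadratic_form I (\<Phi> s) z" for s
  define B where "B m s = (\<Sum>i\<in>I. \<Phi> s (m, None) i * z i)" for m s
  have bound: "quadratic_form I (schur_bound K c (\<gamma> - \<epsilon>) \<eta> (\<Phi> s)) z =
      Q s + (\<Sum>m<\<kappa>. (B m s)\<^sup>2) / c + \<eta> * (\<Sum>k<\<kappa>. \<Sum>p\<in>T. (\<zeta> k p)\<^sup>2)" for \<eta> s
    unfolding schur_bound_form[OF I(1,2)] zform zsum zsq Q_def B_def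
    by (simp add: zK) (simp add: K_def sum.cartesian_product')
  have flip: "\<Phi> (- s) i j = (if i \<in> K \<longleftrightarrow> j \<in> K then \<Phi> s i j else - \<Phi> s i j)"
    if "i \<in> I" "j \<in> I" for i j s
  proof -
    define \<sigma> :: "'a option \<Rightarrow> real" where "\<sigma> = (\<lambda>P. if P = None then - 1 else 1)"
    have "act S (border a b (- s)) w (unit_at (snd j)) (snd i) =
        \<sigma> (snd i) * \<sigma> (snd j) * act S (border a b s) w (unit_at (snd j)) (snd i)" for w
    proof -
      have "act S (border a b (- s)) w (unit_at (snd j)) (snd i) =
          \<sigma> (snd i) * act S (border a b s) w (\<lambda>Q. \<sigma> Q * unit_at (snd j) Q) (snd i)"
        unfolding S_def \<sigma>_def by (rule act_border_flip[OF T])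
      also have "(\<lambda>Q. \<sigma> Q * unit_at (snd j) Q) = (\<lambda>Q. \<sigma> (snd j) * unit_at (snd j) Q)" by auto
      finally show ?thesis by (simp only: act_scale mult.assoc)
    qed
    then have "\<Phi> (- s) i j = \<sigma> (snd i) * \<sigma> (snd j) * \<Phi> s i j"
      by (simp add: \<Phi>_def eval_kernel_def sum_distrib_left mult_ac)
    moreover have "i \<in> K \<longleftrightarrow> snd i = None" "j \<in> K \<longleftrightarrow> snd j = None"
      using that by (auto simp: I_def K_def)
    ultimately show ?thesis by (auto simp: \<sigma>_def)
  qed
  have ineq: "0 \<le> (Q s - Q 0) / s\<^sup>2 + (\<Sum>m<\<kappa>. (B m s / s)\<^sup>2) / c + \<epsilon> * (\<Sum>k<\<kappa>. \<Sum>p\<in>T. (\<zeta> k p)\<^sup>2)"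
    if s: "s \<noteq> 0" "s\<^sup>2 \<le> 1" and sm: "\<forall>i\<in>I. \<forall>j\<in>I. \<bar>\<Phi> s i j\<bar> < e" for s
  proof -
    \<comment> \<open>The margin has to be of order \<open>s\<^sup>2\<close> so as not to swamp the second variation.\<close>
    define \<eta> where "\<eta> = s\<^sup>2 * \<epsilon>"
    define M where "M = schur_bound K c (\<gamma> - \<epsilon>) \<eta> (\<Phi> s)"
    have "s\<^sup>2 * \<epsilon> \<le> 1 * (\<gamma> / 4)" using s eps by (intro mult_mono) auto
    then have \<eta>: "0 < \<eta>" "\<eta> \<le> \<gamma> / 4" using s eps by (auto simp: \<eta>_def)
    have ecard: "e * card I \<le> \<epsilon> / 2" using small(2) by (simp add: I_def S_def)
    have eK: "e * card K < (\<gamma> - \<epsilon>) - c"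
    proof -
      have "e * card K \<le> e * card I"
        using small(1) card_mono[OF I(1,2)] by (intro mult_left_mono) auto
      then show ?thesis using ecard eps by (simp add: c_def)
    qed
    have le: "\<bar>\<Phi> s i j\<bar> \<le> e" if "i \<in> I" "j \<in> I" for i j
      using sm that by (simp add: less_imp_le)
    have leK: "\<bar>\<Phi> s i j\<bar> \<le> e" "\<bar>\<Phi> (- s) i j\<bar> \<le> e" if "i \<in> K" "j \<in> K" for i j
    proof -
      have "i \<in> I" "j \<in> I" using that I(2) by auto
      then show "\<bar>\<Phi> s i j\<bar> \<le> e" "\<bar>\<Phi> (- s) i j\<bar> \<le> e"
        using le[of i j] flip[of i j s] that by simp_all
    qed
    have Msym: "M i j = M j i" if "i \<in> I" "j \<in> I" for i j
      using sym[OF that] by (auto simp: M_def schur_bound_def mult.commute)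
    have M\<gamma>: "pos_on I (\<lambda>i j. (if i = j then \<gamma> else 0) - M i j)"
      unfolding M_def c_def
      by (rule schur_bound_less[OF I(1,2) eps \<eta>(2) le less_imp_le[OF small(1)] ecard])
    have M1: "pos_on I (\<lambda>i j. M i j - \<Phi> s i j)"
      unfolding M_def by (rule schur_bound_dominates[OF I(1,2) sym c \<eta>(1) leK(1) eK])
    have M2: "pos_on I (\<lambda>i j. M i j - \<Phi> (- s) i j)"
    proof -
      have "pos_on I (\<lambda>i j. schur_bound K c (\<gamma> - \<epsilon>) \<eta> (\<Phi> (- s)) i j - \<Phi> (- s) i j)"
        by (rule schur_bound_dominates[OF I(1,2) sym c \<eta>(1) leK(2) eK])
      moreover have eq: "schur_bound K c (\<gamma> - \<epsilon>) \<eta> (\<Phi> (- s)) i j = M i j" if "i \<in> I" "j \<in> I" for i j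
        unfolding M_def using I(2) flip that by (rule schur_bound_flip)
      have "quadratic_form I (\<lambda>i j. schur_bound K c (\<gamma> - \<epsilon>) \<eta> (\<Phi> (- s)) i j - \<Phi> (- s) i j) v =
          quadratic_form I (\<lambda>i j. M i j - \<Phi> (- s) i j) v" for v
        by (rule quadratic_form_cong) (simp only: eq)
      ultimately show ?thesis by (simp only: pos_on_def)
    qed
    have mid: "pos_on I (\<lambda>i j. M i j -
        eval_kernel S f (\<lambda>i P Q. (border a b s i P Q + border a b (- s) i P Q) / 2) i j)"
      unfolding I_def
    proof (rule sublevel_midpoint[OF f q S])
      show "border a b s i P Q = border a b s i Q P" for i P Q using a by (rule border_sym)
      show "border a b (- s) i P Q = border a b (- s) i Q P" for i P Q using a by (rule border_sym)
    qed (use Msym M\<gamma> M1 M2 in \<open>simp_all add: I_def \<Phi>_def\<close>)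
    have "border a b 0 = (\<lambda>i P Q. (border a b s i P Q + border a b (- s) i P Q) / 2)"
      by (intro ext) (auto simp: border_def split: option.splits)
    then have "pos_on I (\<lambda>i j. M i j - \<Phi> 0 i j)"
      using mid by (simp add: \<Phi>_def)
    then have "0 \<le> quadratic_form I (\<lambda>i j. M i j - \<Phi> 0 i j) z"
      unfolding pos_on_def by (cases "\<exists>i\<in>I. z i \<noteq> 0") (auto simp: quadratic_form_def)
    then have "0 \<le> (Q s - Q 0 + (\<Sum>m<\<kappa>. (B m s)\<^sup>2) / c + \<eta> * (\<Sum>k<\<kappa>. \<Sum>p\<in>T. (\<zeta> k p)\<^sup>2)) / s\<^sup>2"
      unfolding quadratic_form_minus M_def bound Q_def[of 0, symmetric] by simp
    also have "\<dots> = (Q s - Q 0) / s\<^sup>2 + (\<Sum>m<\<kappa>. (B m s / s)\<^sup>2) / c + \<epsilon> * (\<Sum>k<\<kappa>. \<Sum>p\<in>T. (\<zeta> k p)\<^sup>2)"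
      using s by (simp add: \<eta>_def add_divide_distrib power_divide sum_divide_distrib mult.commute)
    finally show ?thesis .
  qed
  have ev: "\<forall>\<^sub>F s in at 0. s \<noteq> 0 \<and> s\<^sup>2 \<le> 1 \<and> (\<forall>i\<in>I. \<forall>j\<in>I. \<bar>\<Phi> s i j\<bar> < e)"
  proof (intro eventually_conj)
    show "\<forall>\<^sub>F s in at (0::real). s \<noteq> 0" by (simp add: eventually_at_filter)
    have "((\<lambda>s::real. s\<^sup>2) \<longlongrightarrow> 0) (at 0)" by (rule tendsto_eq_intros refl | simp)+
    then have "\<forall>\<^sub>F s::real in at 0. s\<^sup>2 < 1" by (rule order_tendstoD) simp
    then show "\<forall>\<^sub>F s::real in at 0. s\<^sup>2 \<le> 1" by eventually_elim simp
    have "\<forall>\<^sub>F s in at 0. \<bar>\<Phi> s i j\<bar> < e" if "i \<in> I" "j \<in> I" for i j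
    proof -
      have "((\<lambda>s. \<Phi> s i j) \<longlongrightarrow> \<Phi> 0 i j) (at 0)"
        unfolding \<Phi>_def eval_kernel_def S_def by (intro tendsto_intros act_border_continuous T)
      then have "((\<lambda>s. \<bar>\<Phi> s i j\<bar>) \<longlongrightarrow> \<bar>\<Phi> 0 i j\<bar>) (at 0)" by (rule tendsto_rabs)
      then show ?thesis
        by (rule order_tendstoD) (use small(3) that in \<open>simp add: \<Phi>_def I_def S_def\<close>)
    qed
    then show "\<forall>\<^sub>F s in at 0. \<forall>i\<in>I. \<forall>j\<in>I. \<bar>\<Phi> s i j\<bar> < e"
      using I(1) by (simp add: eventually_ball_finite_distrib)
  qed
  have Qlim: "((\<lambda>s. (Q s - Q 0) / s\<^sup>2) \<longlongrightarrow> second_order_form \<kappa> f (\<lambda>k. moment T a b (\<zeta> k))) (at 0)"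
  proof -
    have Qs: "Q s = (\<Sum>w\<in>ncp_support f. \<Sum>k<\<kappa>. \<Sum>l<\<kappa>. f w $$ (k, l) *
        (\<Sum>p\<in>T. \<zeta> k p * act S (border a b s) w (case_option 0 (\<zeta> l)) (Some p)))" for s
      unfolding Q_def \<Phi>_def I_def eval_kernel_form[OF S(1)] z_eq
      by (simp add: S_def sum_bordered[OF T] z_def)
    have Q0: "Q 0 = (\<Sum>w\<in>ncp_support f. \<Sum>k<\<kappa>. \<Sum>l<\<kappa>. f w $$ (k, l) *
        (\<Sum>p\<in>T. \<zeta> k p * act T a w (\<zeta> l) p))"
      unfolding Qs S_def act_border_zero(1)[OF T] by simp
    have "(Q s - Q 0) / s\<^sup>2 = (\<Sum>w\<in>ncp_support f. \<Sum>k<\<kappa>. \<Sum>l<\<kappa>. f w $$ (k, l) *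
        (\<Sum>p\<in>T. \<zeta> k p * ((act S (border a b s) w (case_option 0 (\<zeta> l)) (Some p) - act T a w (\<zeta> l) p) / s\<^sup>2)))"
      for s
      unfolding Q0 Qs[of s]
      by (simp only: sum_subtractf[symmetric] right_diff_distrib[symmetric] sum_divide_distrib times_divide_eq_right[symmetric])
    moreover have "((\<lambda>s. \<Sum>w\<in>ncp_support f. \<Sum>k<\<kappa>. \<Sum>l<\<kappa>. f w $$ (k, l) *
        (\<Sum>p\<in>T. \<zeta> k p * ((act S (border a b s) w (case_option 0 (\<zeta> l)) (Some p) - act T a w (\<zeta> l) p) / s\<^sup>2)))
      \<longlongrightarrow> (\<Sum>w\<in>ncp_support f. \<Sum>k<\<kappa>. \<Sum>l<\<kappa>. f w $$ (k, l) *
        (\<Sum>p\<in>T. \<zeta> k p * second_variation T a b (\<zeta> l) w p))) (at 0)"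
      unfolding S_def by (intro tendsto_intros act_border_limits[OF T])
    moreover have "(\<Sum>p\<in>T. \<zeta> k p * second_variation T a b (\<zeta> l) w p) =
       (\<Sum>m\<in>{1..length w}. moment T a b (\<zeta> k) (rev (take m w)) * moment T a b (\<zeta> l) (drop m w))" for k l w
      using act_second_variation[where a = a and b = b and r = "[]" and \<xi> = "\<zeta> k" and \<zeta> = "\<zeta> l" and w = w, OF T a] by simp
    ultimately show ?thesis by (simp add: second_order_form_def)
  qed
  have Blim: "((\<lambda>s. B k s / s) \<longlongrightarrow>
      (\<Sum>w\<in>ncp_support f. \<Sum>l<\<kappa>. f w $$ (k, l) * moment T a b (\<zeta> l) w)) (at 0)" for k
  proof -
    have "B k s / s = (\<Sum>w\<in>ncp_support f. \<Sum>l<\<kappa>. f w $$ (k, l) *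
        (act S (border a b s) w (case_option 0 (\<zeta> l)) None / s))" for s
      unfolding B_def \<Phi>_def I_def
      by (subst eval_kernel_apply) (auto simp: S z_eq S_def T sum_divide_distrib)
    then show ?thesis
      unfolding S_def by (simp only:) (intro tendsto_intros act_border_limits[OF T])
  qed
  have "((\<lambda>s. (Q s - Q 0) / s\<^sup>2 + (\<Sum>m<\<kappa>. (B m s / s)\<^sup>2) / c + \<epsilon> * (\<Sum>k<\<kappa>. \<Sum>p\<in>T. (\<zeta> k p)\<^sup>2)) \<longlongrightarrow>
     second_order_form \<kappa> f (\<lambda>k. moment T a b (\<zeta> k)) + first_order_norm \<kappa> f (\<lambda>k. moment T a b (\<zeta> k)) / c
     + \<epsilon> * (\<Sum>k<\<kappa>. \<Sum>p\<in>T. (\<zeta> k p)\<^sup>2)) (at 0)"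
    unfolding first_order_norm_def using c by (intro tendsto_intros Qlim Blim) simp
  then have "0 \<le> second_order_form \<kappa> f (\<lambda>k. moment T a b (\<zeta> k)) + first_order_norm \<kappa> f (\<lambda>k. moment T a b (\<zeta> k)) / c
     + \<epsilon> * (\<Sum>k<\<kappa>. \<Sum>p\<in>T. (\<zeta> k p)\<^sup>2)"
    by (rule tendsto_lowerbound) (use ev ineq in \<open>auto elim!: eventually_mono\<close>)
  then show ?thesis by (simp add: c_def)
qed

lemma length_le_degree:
  assumes "f \<in> ncpolys g r c" "w \<in> ncp_support f"
  shows "length w \<le> ncp_degree f"
  using assms by (auto simp: ncp_degree_def ncpolys_def intro!: Max_ge)

section \<open>Prescribing the moments on a truncated Fock space\<close>

definition words :: "nat \<Rightarrow> nat \<Rightarrow> nat list set" where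
  "words g d = {w \<in> lists {..<g}. length w \<le> d}"

lemma finite_words: "finite (words g d)"
  using finite_lists_length_le[of "{..<g}" d] by (simp add: words_def lists_eq_set conj_commute)

text \<open>Sum of creation and annihilation of the letter \<open>i\<close> on the free Fock space over the words, with
\<open>\<kappa>\<close> copies of that space marked by the second component.\<close>

definition fock :: "nat \<Rightarrow> nat list \<times> nat \<Rightarrow> nat list \<times> nat \<Rightarrow> real" where
  "fock i p q = (if snd p = snd q \<and> (fst p = i # fst q \<or> fst q = i # fst p) then 1 else 0)"

lemma fock_sym: "fock i p q = fock i q p"
  by (auto simp: fock_def)

lemma act_scale_tuple: "act S (\<lambda>i p q. c * x i p q) w v p = c ^ length w * act S x w v p"
  by (induction w arbitrary: p) (auto simp: sum_distrib_left mult_ac)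

text \<open>Applying the letters of \<open>t\<close> to the vacuum gives the basis vector \<open>t\<close> plus shorter words, since
annihilation only shortens. Hence these vectors are linearly independent.\<close>

lemma fock_triangular:
  assumes "t \<in> lists {..<g}" "v \<in> words g d" "l < \<kappa>" "length t \<le> length v \<or> l \<noteq> k"
  shows "act (words g d \<times> {..<\<kappa>}) fock t (unit_at ([], k)) (v, l) = (if v = t \<and> l = k then 1 else 0)"
  using assms
proof (induction t arbitrary: v)
  case (Cons i t)
  let ?T = "words g d \<times> {..<\<kappa>}"
  have vanish: "fock i (v, l) r * act ?T fock t (unit_at ([], k)) r =
      (if r = (t, k) then (if v = i # t \<and> l = k then 1 else 0) else 0)" if r: "r \<in> ?T" for r
  proof (cases "fock i (v, l) r = 0")
    case True
    then show ?thesis by (auto simp: fock_def split: if_splits)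
  next
    case False
    then have *: "snd r = l" "v = i # fst r \<or> fst r = i # v" "fock i (v, l) r = 1"
      by (auto simp: fock_def split: if_splits)
    have "act ?T fock t (unit_at ([], k)) (fst r, l) = (if fst r = t \<and> l = k then 1 else 0)"
      using Cons.prems * r by (intro Cons.IH) auto
    moreover have "l = k \<Longrightarrow> fst r = t \<Longrightarrow> v = i # t" using * Cons.prems by auto
    ultimately show ?thesis using * by (cases r) auto
  qed
  have "act ?T fock (i # t) (unit_at ([], k)) (v, l) =
     (\<Sum>r\<in>?T. if r = (t, k) then (if v = i # t \<and> l = k then 1 else 0) else 0)"
    unfolding act.simps by (rule sum.cong[OF refl vanish])
  also have "\<dots> = (if (t, k) \<in> ?T then (if v = i # t \<and> l = k then 1 else 0) else 0)"
    using finite_words by (intro sum.delta) simp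
  also have "\<dots> = (if v = i # t \<and> l = k then 1 else 0)"
    using Cons.prems by (auto simp: words_def)
  finally show ?case .
qed auto

text \<open>Triangularity lets a linear functional be prescribed on the vectors \<open>t(a) vacuum\<close>, by recursion on
the length of \<open>t\<close>.\<close>

lemma fock_functional:
  "\<exists>b. \<forall>k<\<kappa>. \<forall>t\<in>words g d.
     (\<Sum>p\<in>words g d \<times> {..<\<kappa>}. b p * act (words g d \<times> {..<\<kappa>}) fock t (unit_at ([], k)) p) = \<tau> k t"
proof -
  let ?T = "words g d \<times> {..<\<kappa>}"
  let ?A = "\<lambda>t k. act ?T fock t (unit_at ([], k))"
  have fin: "finite ?T" using finite_words by simp
  have "\<exists>b. \<forall>k<\<kappa>. \<forall>t\<in>words g d. length t < L \<longrightarrow> (\<Sum>p\<in>?T. b p * ?A t k p) = \<tau> k t" for L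
  proof (induction L)
    case (Suc L)
    then obtain b where b: "\<And>k t. k < \<kappa> \<Longrightarrow> t \<in> words g d \<Longrightarrow> length t < L \<Longrightarrow>
        (\<Sum>p\<in>?T. b p * ?A t k p) = \<tau> k t" by blast
    define e where "e p = (if length (fst p) = L then
      \<tau> (snd p) (fst p) - (\<Sum>q\<in>?T. b q * ?A (fst p) (snd p) q) else 0)" for p
    have e: "(\<Sum>p\<in>?T. e p * ?A t k p) = (if length t = L then e (t, k) else 0)"
      if "k < \<kappa>" "t \<in> words g d" "length t \<le> L" for k t
    proof -
      have "(\<Sum>p\<in>?T. e p * ?A t k p) = (\<Sum>p\<in>?T. if p = (t, k) then e (t, k) else 0)"
      proof (rule sum.cong[OF refl])
        fix p assume p: "p \<in> ?T"
        show "e p * ?A t k p = (if p = (t, k) then e (t, k) else 0)"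
        proof (cases "length (fst p) = L")
          case True
          have "?A t k (fst p, snd p) = (if fst p = t \<and> snd p = k then 1 else 0)"
            using p that True by (intro fock_triangular) (auto simp: words_def)
          then show ?thesis by (cases p) auto
        next
          case False
          then show ?thesis by (auto simp: e_def)
        qed
      qed
      also have "\<dots> = e (t, k)" using fin that by simp
      finally show ?thesis by (auto simp: e_def)
    qed
    have "(\<Sum>p\<in>?T. (b p + e p) * ?A t k p) = \<tau> k t"
      if "k < \<kappa>" "t \<in> words g d" "length t < Suc L" for k t
    proof -
      have "(\<Sum>p\<in>?T. (b p + e p) * ?A t k p) =
          (\<Sum>p\<in>?T. b p * ?A t k p) + (if length t = L then e (t, k) else 0)"
        using e[OF that(1,2)] that(3) by (simp add: distrib_right sum.distrib)
      then show ?thesis using b[OF that(1,2)] that(3) by (auto simp: e_def)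
    qed
    then show ?case by (intro exI[of _ "\<lambda>p. b p + e p"] allI ballI impI)
  qed auto
  from this[of "Suc d"] show ?thesis by (auto simp: words_def less_Suc_eq_le)
qed

lemma second_order_form_cong:
  assumes f: "f \<in> ncpolys g \<kappa> \<kappa>"
    and eq: "\<And>k u. k < \<kappa> \<Longrightarrow> u \<in> words g (ncp_degree f) \<Longrightarrow> \<pi> k u = \<rho> k u"
  shows "second_order_form \<kappa> f \<pi> = second_order_form \<kappa> f \<rho>"
    and "first_order_norm \<kappa> f \<pi> = first_order_norm \<kappa> f \<rho>"
proof -
  have w: "w \<in> lists {..<g}" "length w \<le> ncp_degree f" if "w \<in> ncp_support f" for w
    using that f length_le_degree[OF f that] by (auto simp: ncpolys_def)
  have len: "min (length w) m \<le> ncp_degree f" if "w \<in> ncp_support f" for w m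
    using w(2)[OF that] by linarith
  have 1: "\<pi> k (rev (take m w)) = \<rho> k (rev (take m w))" "\<pi> k (drop m w) = \<rho> k (drop m w)"
    "\<pi> k w = \<rho> k w"
    if "w \<in> ncp_support f" "k < \<kappa>" for w m k
    using w[OF that(1)] len[OF that(1)] that(2)
    by (auto intro!: eq simp: words_def dest!: in_set_takeD in_set_dropD)
  show "second_order_form \<kappa> f \<pi> = second_order_form \<kappa> f \<rho>"
    unfolding second_order_form_def using 1 by (intro sum.cong refl arg_cong2[of _ _ _ _ "(*)"]) auto
  show "first_order_norm \<kappa> f \<pi> = first_order_norm \<kappa> f \<rho>"
    unfolding first_order_norm_def using 1
    by (intro sum.cong refl arg_cong2[of _ _ _ _ "(*)"] arg_cong[of _ _ "\<lambda>x. x\<^sup>2"]) auto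
qed

text \<open>For a fixed choice of moments, the Fock tuple is scaled by a number \<open>s\<close> so small that \<open>f\<close> has
small entries there; the functionals \<open>b\<^sub>j\<close> are scaled up by \<open>s\<^sup>-\<^sup>|\<^sup>t\<^sup>|\<close> to keep the moments, which costs
nothing as the border carries its own infinitesimal factor. Finally \<open>\<epsilon> \<rightarrow> 0\<close>; the vacuum
vectors, and so the constant \<open>C\<close>, do not depend on \<open>\<epsilon>\<close>.\<close>

lemma second_order_inequality:
  assumes f: "f \<in> ncpolys g \<kappa> \<kappa>" "ncp_symmetric f" and zero: "f [] = 0\<^sub>m \<kappa> \<kappa>"
    and q: "quasiconvex_below g \<kappa> \<gamma> f" and "0 < \<gamma>" and \<pi>: "\<And>k. \<pi> k [] = 0"
  shows "0 \<le> second_order_form \<kappa> f \<pi> + first_order_norm \<kappa> f \<pi> / \<gamma>"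
proof -
  define d where "d = ncp_degree f"
  define T where "T = words g d \<times> {..<\<kappa>}"
  define C where "C = (\<Sum>k<\<kappa>. \<Sum>p\<in>T. (unit_at ([], k) p)\<^sup>2 :: real)"
  have T: "finite T" using finite_words by (simp add: T_def)
  have main: "0 \<le> second_order_form \<kappa> f \<pi> + first_order_norm \<kappa> f \<pi> / (\<gamma> - 2 * \<epsilon>) + \<epsilon> * C"
    if eps: "0 < \<epsilon>" "\<epsilon> \<le> \<gamma> / 4" for \<epsilon>
  proof -
    define I where "I = {..<\<kappa>} \<times> bordered T"
    have finI: "finite I" using T by (simp add: I_def)
    define e where "e = \<epsilon> / (2 * (real (card I) + 1))"
    have e: "0 < e" using eps by (simp add: e_def)
    have "e * card I \<le> e * (real (card I) + 1)" using e by (intro mult_left_mono) auto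
    also have "\<dots> = \<epsilon> / 2" by (simp add: e_def field_simps)
    finally have ecard: "e * card I \<le> \<epsilon> / 2" .
    define x where "x = border fock (\<lambda>_ _. 0) 0"
    have border_x: "border (\<lambda>i p q. s * fock i p q) b 0 = (\<lambda>i p q. s * x i p q)" for b s
      by (auto simp: x_def border_def fun_eq_iff split: option.splits)
    have "\<forall>\<^sub>F s in at 0. \<bar>eval_kernel (bordered T) f (\<lambda>i p q. s * x i p q) i j\<bar> < e"
      if "i \<in> I" "j \<in> I" for i j
    proof -
      have "((\<lambda>s. \<bar>eval_kernel (bordered T) f (\<lambda>i p q. s * x i p q) i j\<bar>) \<longlongrightarrow>
         \<bar>\<Sum>w\<in>ncp_support f. f w $$ (fst i, fst j) *
            (0 ^ length w * act (bordered T) x w (unit_at (snd j)) (snd i))\<bar>) (at 0)"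
        unfolding eval_kernel_def act_scale_tuple by (intro tendsto_intros)
      also have "(\<Sum>w\<in>ncp_support f. f w $$ (fst i, fst j) *
            (0 ^ length w * act (bordered T) x w (unit_at (snd j)) (snd i))) = 0"
      proof (intro sum.neutral ballI)
        fix w
        show "f w $$ (fst i, fst j) *
            (0 ^ length w * act (bordered T) x w (unit_at (snd j)) (snd i)) = 0"
          using that zero by (cases w) (auto simp: I_def)
      qed
      finally show ?thesis by (rule order_tendstoD) (use e in simp)
    qed
    then have "\<forall>\<^sub>F s in at 0. \<forall>i\<in>I. \<forall>j\<in>I. \<bar>eval_kernel (bordered T) f (\<lambda>i p q. s * x i p q) i j\<bar> < e"
      using finI by (simp add: eventually_ball_finite_distrib)
    moreover have "\<forall>\<^sub>F s in at (0::real). s \<noteq> 0"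
      by (simp add: eventually_at_filter)
    ultimately have "\<forall>\<^sub>F s in at (0::real). s \<noteq> 0 \<and>
       (\<forall>i\<in>I. \<forall>j\<in>I. \<bar>eval_kernel (bordered T) f (\<lambda>i p q. s * x i p q) i j\<bar> < e)"
      by (intro eventually_conj)
    from eventually_happens'[OF at_neq_bot this]
    obtain s :: real where s: "s \<noteq> 0"
      and small: "\<And>i j. i \<in> I \<Longrightarrow> j \<in> I \<Longrightarrow> \<bar>eval_kernel (bordered T) f (\<lambda>i p q. s * x i p q) i j\<bar> < e"
      by blast
    define a where "a = (\<lambda>i p q. s * fock i p q)"
    have "\<exists>b. \<forall>j. \<forall>k<\<kappa>. \<forall>t\<in>words g d.
        (\<Sum>p\<in>T. b j p * act T fock t (unit_at ([], k)) p) = \<pi> k (j # t) / s ^ length t"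
      unfolding T_def by (intro choice allI fock_functional)
    then obtain b where b: "\<And>j k t. k < \<kappa> \<Longrightarrow> t \<in> words g d \<Longrightarrow>
        (\<Sum>p\<in>T. b j p * act T fock t (unit_at ([], k)) p) = \<pi> k (j # t) / s ^ length t"
      by blast
    have moment: "moment T a b (unit_at ([], k)) u = \<pi> k u" if "k < \<kappa>" "u \<in> words g d" for k u
    proof (cases u)
      case Nil
      then show ?thesis by (simp add: \<pi>)
    next
      case (Cons j t)
      then have "t \<in> words g d" using that by (auto simp: words_def)
      then have "s ^ length t * (\<Sum>p\<in>T. b j p * act T fock t (unit_at ([], k)) p) = \<pi> k u"
        using b that s Cons by simp
      then show ?thesis
        by (simp add: Cons a_def act_scale_tuple sum_distrib_left mult_ac)
    qed
    have "0 \<le> second_order_form \<kappa> f (\<lambda>k. moment T a b (unit_at ([], k)))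
       + first_order_norm \<kappa> f (\<lambda>k. moment T a b (unit_at ([], k))) / (\<gamma> - 2 * \<epsilon>)
       + \<epsilon> * (\<Sum>k<\<kappa>. \<Sum>p\<in>T. (unit_at ([], k) p)\<^sup>2)"
    proof (rule second_order_inequality_bordered[OF f q T _ eps e])
      show "a i p r = a i r p" for i p r by (simp add: a_def fock_sym)
      show "e * card ({..<\<kappa>} \<times> bordered T) \<le> \<epsilon> / 2" using ecard by (simp add: I_def)
      show "\<bar>eval_kernel (bordered T) f (border a b 0) i j\<bar> < e"
        if "i \<in> {..<\<kappa>} \<times> bordered T" "j \<in> {..<\<kappa>} \<times> bordered T" for i j
        using small[of i j] that unfolding a_def border_x by (simp add: I_def)
    qed
    moreover have "second_order_form \<kappa> f (\<lambda>k. moment T a b (unit_at ([], k))) = second_order_form \<kappa> f \<pi>"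
      "first_order_norm \<kappa> f (\<lambda>k. moment T a b (unit_at ([], k))) = first_order_norm \<kappa> f \<pi>"
      using moment by (auto intro!: second_order_form_cong[OF f(1)] simp: d_def)
    ultimately show ?thesis by (simp add: C_def)
  qed
  have lim: "((\<lambda>\<epsilon>. second_order_form \<kappa> f \<pi> + first_order_norm \<kappa> f \<pi> / (\<gamma> - 2 * \<epsilon>) + \<epsilon> * C) \<longlongrightarrow>
      second_order_form \<kappa> f \<pi> + first_order_norm \<kappa> f \<pi> / (\<gamma> - 2 * 0) + 0 * C) (at_right 0)"
    using \<open>0 < \<gamma>\<close> by (intro tendsto_intros) auto
  have "\<forall>\<^sub>F \<epsilon> in at_right 0. 0 \<le> second_order_form \<kappa> f \<pi> + first_order_norm \<kappa> f \<pi> / (\<gamma> - 2 * \<epsilon>) + \<epsilon> * C"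
    using \<open>0 < \<gamma>\<close> main by (intro eventually_at_rightI[of 0 "\<gamma> / 4"]) auto
  then show ?thesis
    using tendsto_lowerbound[OF lim] by simp
qed

section \<open>Linear algebra: Gram matrices, the Hankel form and block rows\<close>

lemma quadratic_nonneg_imp_linear_zero:
  fixes a b :: real
  assumes "\<And>t. 0 \<le> t\<^sup>2 * a + 2 * t * b"
  shows "b = 0"
proof (rule ccontr)
  assume b: "b \<noteq> 0"
  define c where "c = \<bar>a\<bar> + 1"
  have c: "0 < c" "a - 2 * c < 0" by (auto simp: c_def)
  have "(- b / c)\<^sup>2 * a + 2 * (- b / c) * b = (b / c)\<^sup>2 * (a - 2 * c)"
    using c by (simp add: power2_eq_square field_simps)
  moreover have "(b / c)\<^sup>2 * (a - 2 * c) < 0"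
    using b c by (intro mult_pos_neg) auto
  ultimately show False using assms[of "- b / c"] by simp
qed

text \<open>Symmetric elimination: the row of the new index \<open>x\<close>, divided by the square root of the diagonal
entry, is one of the vectors, and subtracting its square clears row and column \<open>x\<close>.\<close>

lemma positive_semidefinite_gram:
  fixes A :: "'i \<Rightarrow> 'i \<Rightarrow> real"
  assumes "finite I" and "\<And>i j. i \<in> I \<Longrightarrow> j \<in> I \<Longrightarrow> A i j = A j i"
    and "\<And>v. 0 \<le> quadratic_form I A v"
  shows "\<exists>N s. \<forall>i\<in>I. \<forall>j\<in>I. A i j = (\<Sum>m<(N::nat). s m i * s m j)"
  using assms
proof (induction I arbitrary: A rule: finite_induct)
  case empty
  then show ?case by simp
next
  case (insert x I)
  have sym: "A i j = A j i" if "i \<in> insert x I" "j \<in> insert x I" for i j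
    using insert.prems(1) that by blast
  have expand: "quadratic_form (insert x I) A v =
      v x * A x x * v x + 2 * v x * (\<Sum>i\<in>I. A x i * v i) + quadratic_form I A v" for v
  proof -
    have "(\<Sum>i\<in>I. v i * A i x * v x) = (\<Sum>i\<in>I. v x * A x i * v i)"
      using sym by (intro sum.cong) (auto simp: mult_ac)
    then show ?thesis
      using insert.hyps
      by (simp add: quadratic_form_def sum.distrib sum_distrib_left mult_ac)
  qed
  have diag: "0 \<le> A x x"
  proof -
    have "quadratic_form I A (unit_at x) = 0"
      using insert.hyps by (auto simp: quadratic_form_def intro!: sum.neutral)
    moreover have "(\<Sum>i\<in>I. A x i * unit_at x i) = 0"
      using insert.hyps by (auto intro!: sum.neutral)
    ultimately show ?thesis using insert.prems(2)[of "unit_at x"] expand[of "unit_at x"] by simp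
  qed
  \<comment> \<open>A vanishing diagonal entry forces its row to vanish, so \<open>c = 0\<close> is the right inverse then.\<close>
  define c where "c = (if A x x = 0 then 0 else 1 / A x x)"
  have row: "A x i * (1 - A x x * c) = 0" if "i \<in> insert x I" for i
  proof (cases "A x x = 0 \<and> i \<in> I")
    case True
    have "0 \<le> t\<^sup>2 * A i i + 2 * t * A x i" for t
    proof -
      define v where "v = (\<lambda>j. if j = x then 1 else if j = i then t else 0)"
      have v: "v j = t * unit_at i j" if "j \<in> I" for j
        using that insert.hyps by (auto simp: v_def)
      have "quadratic_form I A v = quadratic_form I A (\<lambda>j. t * unit_at i j)"
        by (simp add: quadratic_form_def v)
      also have "\<dots> = (\<Sum>p\<in>I. if p = i then t\<^sup>2 * A i i else 0)"
        unfolding quadratic_form_def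
      proof (rule sum.cong[OF refl])
        fix p
        show "(\<Sum>j\<in>I. t * unit_at i p * A p j * (t * unit_at i j)) = (if p = i then t\<^sup>2 * A i i else 0)"
          using insert.hyps True
          by (cases "p = i") (simp_all add: if_distrib[of "\<lambda>c. _ * c"] power2_eq_square cong: if_cong)
      qed
      also have "\<dots> = t\<^sup>2 * A i i" using insert.hyps True by simp
      finally have 1: "quadratic_form I A v = t\<^sup>2 * A i i" .
      have "(\<Sum>j\<in>I. A x j * v j) = (\<Sum>j\<in>I. A x j * (t * unit_at i j))"
        by (simp add: v)
      also have "\<dots> = t * A x i"
        using insert.hyps True
        by (simp add: if_distrib[of "\<lambda>c. _ * c"] mult_ac cong: if_cong)
      finally show ?thesis
        using insert.prems(2)[of v] 1 True unfolding expand by (simp add: v_def mult_ac)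
    qed
    then have "A x i = 0" by (rule quadratic_nonneg_imp_linear_zero)
    then show ?thesis by simp
  next
    case False
    then show ?thesis using that by (auto simp: c_def)
  qed
  define A' where "A' i j = A i j - c * A x i * A x j" for i j
  have "0 \<le> quadratic_form I A' v" for v
  proof -
    define S where "S = (\<Sum>i\<in>I. A x i * v i)"
    \<comment> \<open>A value at \<open>x\<close> that minimizes the form for given values on \<open>I\<close>.\<close>
    define u where "u = v(x := - c * S)"
    have u: "u i = v i" if "i \<in> I" for i using that insert.hyps by (auto simp: u_def)
    have "quadratic_form I (\<lambda>i j. c * A x i * A x j) v = c * S\<^sup>2"
      by (simp add: quadratic_form_def S_def power2_eq_square sum_product sum_distrib_left mult_ac)
    moreover have "quadratic_form (insert x I) A u = c * (A x x * c) * S\<^sup>2 - 2 * c * S\<^sup>2 + quadratic_form I A v"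
    proof -
      have "quadratic_form I A u = quadratic_form I A v" by (simp add: quadratic_form_def u)
      moreover have "(\<Sum>i\<in>I. A x i * u i) = S" by (simp add: S_def u)
      moreover have "u x = - c * S" by (simp add: u_def)
      ultimately show ?thesis unfolding expand by (simp add: power2_eq_square mult_ac)
    qed
    moreover have "c * (A x x * c) = c" by (simp add: c_def)
    ultimately have "quadratic_form I A' v = quadratic_form (insert x I) A u"
      unfolding A'_def [abs_def] quadratic_form_minus by simp
    then show ?thesis using insert.prems(2) by simp
  qed
  moreover have "A' i j = A' j i" if "i \<in> I" "j \<in> I" for i j
    using sym[of i j] that by (simp add: A'_def mult_ac)
  ultimately obtain N s where s: "\<And>i j. i \<in> I \<Longrightarrow> j \<in> I \<Longrightarrow> A' i j = (\<Sum>m<(N::nat). s m i * s m j)"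
    using insert.IH[of A'] by blast
  define s' where "s' m i = (if m = N then sqrt c * A x i else if i = x then 0 else s m i)" for m i
  have c: "0 \<le> c" using diag by (simp add: c_def)
  have "A i j = (\<Sum>m<Suc N. s' m i * s' m j)" if ij: "i \<in> insert x I" "j \<in> insert x I" for i j
  proof -
    have "(\<Sum>m<Suc N. s' m i * s' m j) = (\<Sum>m<N. if i = x \<or> j = x then 0 else s m i * s m j) + c * A x i * A x j"
    proof -
      have "s' N i * s' N j = (sqrt c * sqrt c) * (A x i * A x j)"
        unfolding s'_def by (simp only: simp_thms if_True mult_ac)
      moreover have "(\<Sum>m<N. s' m i * s' m j) = (\<Sum>m<N. if i = x \<or> j = x then 0 else s m i * s m j)"
        by (rule sum.cong) (auto simp: s'_def)
      ultimately show ?thesis using c by simp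
    qed
    also have "\<dots> = A i j"
    proof (cases "i = x \<or> j = x")
      case True
      have "A x x * (c * A x i) = A x i" if "i \<in> insert x I" for i
        using row[OF that] by (simp add: algebra_simps)
      then have "c * A x i * A x j = A i j"
        using True ij sym[of i x] by (auto simp: mult_ac)
      then show ?thesis using True by simp
    next
      case False
      then show ?thesis using s[of i j] ij by (auto simp: A'_def)
    qed
    finally show ?thesis by simp
  qed
  then show ?case by blast
qed

lemma coeff_outside_support:
  assumes "f \<in> ncpolys g \<kappa> \<kappa>" "w \<notin> ncp_support f" "k < \<kappa>" "l < \<kappa>"
  shows "f w $$ (k, l) = 0"
proof -
  have "f w \<in> carrier_mat \<kappa> \<kappa>" using assms(1) by (auto simp: ncpolys_def)
  then have "f w = 0\<^sub>m \<kappa> \<kappa>" using assms(2) by (simp add: ncp_support_def)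
  then show ?thesis using assms by simp
qed

text \<open>The term of the Hankel form that belongs to the words \<open>u\<close> and \<open>v\<close>.\<close>

definition pairing ::
  "nat \<Rightarrow> ncpoly \<Rightarrow> (nat \<Rightarrow> nat list \<Rightarrow> real) \<Rightarrow> nat list \<Rightarrow> nat list \<Rightarrow> real" where
  "pairing \<kappa> f \<pi> u v = (\<Sum>k<\<kappa>. \<Sum>l<\<kappa>. f (rev u @ v) $$ (k, l) * (\<pi> k u * \<pi> l v))"

lemma pairing_sym:
  assumes "f \<in> ncpolys g \<kappa> \<kappa>" "ncp_symmetric f"
  shows "pairing \<kappa> f \<pi> u v = pairing \<kappa> f \<pi> v u"
proof -
  have "f (rev u @ v) $$ (k, l) = f (rev v @ u) $$ (l, k)" if "k < \<kappa>" "l < \<kappa>" for k l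
    using symmetric_coeff[OF assms(2,1) that, of "rev v @ u"] by simp
  then have "pairing \<kappa> f \<pi> u v = (\<Sum>k<\<kappa>. \<Sum>l<\<kappa>. f (rev v @ u) $$ (l, k) * (\<pi> l v * \<pi> k u))"
    unfolding pairing_def by (intro sum.cong refl) (simp add: mult_ac)
  also have "\<dots> = pairing \<kappa> f \<pi> v u"
    unfolding pairing_def by (rule sum.swap)
  finally show ?thesis .
qed

lemma pairing_degree:
  assumes "f \<in> ncpolys g \<kappa> \<kappa>" "ncp_degree f < length u + length v"
  shows "pairing \<kappa> f \<pi> u v = 0"
proof -
  have "rev u @ v \<notin> ncp_support f" using length_le_degree[OF assms(1), of "rev u @ v"] assms(2) by auto
  then show ?thesis
    by (simp add: pairing_def coeff_outside_support[OF assms(1)])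
qed

text \<open>A word \<open>w\<close> with a cut at \<open>m \<ge> 1\<close> is the same as a pair \<open>(u, v)\<close> with \<open>u \<noteq> []\<close> and
\<open>w = rev u @ v\<close>.\<close>

lemma second_order_form_pairing:
  assumes f: "f \<in> ncpolys g \<kappa> \<kappa>" and U: "finite U" "[] \<notin> U"
    and \<pi>: "\<And>k u. k < \<kappa> \<Longrightarrow> u \<notin> U \<Longrightarrow> \<pi> k u = 0"
  shows "second_order_form \<kappa> f \<pi> = (\<Sum>u\<in>U. \<Sum>v\<in>U. pairing \<kappa> f \<pi> u v)"
proof -
  define P where "P = (SIGMA w:ncp_support f. {1..length w})"
  define Q where "Q = {(u, v). u \<noteq> [] \<and> rev u @ v \<in> ncp_support f}"
  have fin: "finite (ncp_support f)" using f by (simp add: ncpolys_def)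
  have "second_order_form \<kappa> f \<pi> =
     (\<Sum>w\<in>ncp_support f. \<Sum>m\<in>{1..length w}. pairing \<kappa> f \<pi> (rev (take m w)) (drop m w))"
  proof -
    have "(\<Sum>k<\<kappa>. \<Sum>l<\<kappa>. f w $$ (k, l) * (\<Sum>m\<in>{1..length w}. \<pi> k (rev (take m w)) * \<pi> l (drop m w)))
      = (\<Sum>m\<in>{1..length w}. pairing \<kappa> f \<pi> (rev (take m w)) (drop m w))" for w
    proof -
      have "(\<Sum>k<\<kappa>. \<Sum>l<\<kappa>. \<Sum>m\<in>{1..length w}. f w $$ (k, l) * (\<pi> k (rev (take m w)) * \<pi> l (drop m w)))
        = (\<Sum>k<\<kappa>. \<Sum>m\<in>{1..length w}. \<Sum>l<\<kappa>. f w $$ (k, l) * (\<pi> k (rev (take m w)) * \<pi> l (drop m w)))"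
        by (intro sum.cong refl sum.swap)
      also have "\<dots> = (\<Sum>m\<in>{1..length w}. \<Sum>k<\<kappa>. \<Sum>l<\<kappa>. f w $$ (k, l) * (\<pi> k (rev (take m w)) * \<pi> l (drop m w)))"
        by (rule sum.swap)
      finally show ?thesis by (simp add: pairing_def sum_distrib_left)
    qed
    then show ?thesis by (simp add: second_order_form_def)
  qed
  also have "\<dots> = (\<Sum>(w, m)\<in>P. pairing \<kappa> f \<pi> (rev (take m w)) (drop m w))"
    unfolding P_def using fin by (subst sum.Sigma) auto
  also have "\<dots> = (\<Sum>(u, v)\<in>Q. pairing \<kappa> f \<pi> u v)"
    by (rule sum.reindex_bij_witness[of _ "\<lambda>(u, v). (rev u @ v, length u)" "\<lambda>(w, m). (rev (take m w), drop m w)"])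
      (auto simp: P_def Q_def Suc_le_eq)
  also have "\<dots> = (\<Sum>(u, v)\<in>U \<times> U. pairing \<kappa> f \<pi> u v)"
  proof (rule sum.mono_neutral_cong)
    have "Q \<subseteq> (\<lambda>(w, m). (rev (take m w), drop m w)) ` P"
    proof clarify
      fix u v assume "(u, v) \<in> Q"
      then have "(rev u @ v, length u) \<in> P" by (auto simp: P_def Q_def Suc_le_eq)
      then show "(u, v) \<in> (\<lambda>(w, m). (rev (take m w), drop m w)) ` P"
        by (rule image_eqI[rotated]) simp
    qed
    moreover have "finite P" using fin by (simp add: P_def)
    ultimately show "finite Q" by (meson finite_surj)
    show "finite (U \<times> U)" using U by simp
    have outside: "pairing \<kappa> f \<pi> u v = 0" if "u \<notin> U \<or> v \<notin> U \<or> rev u @ v \<notin> ncp_support f" for u v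
      unfolding pairing_def using that \<pi> coeff_outside_support[OF f, of "rev u @ v"]
      by (intro sum.neutral ballI) auto
    show "(case p of (u, v) \<Rightarrow> pairing \<kappa> f \<pi> u v) = 0" if "p \<in> U \<times> U - Q" for p
      using that U by (cases p) (auto simp: Q_def intro!: outside)
    show "(case p of (u, v) \<Rightarrow> pairing \<kappa> f \<pi> u v) = 0" if "p \<in> Q - U \<times> U" for p
      using that by (cases p) (auto intro!: outside)
  qed simp
  finally show ?thesis by (simp add: sum.cartesian_product)
qed

lemma first_order_norm_support:
  assumes f: "f \<in> ncpolys g \<kappa> \<kappa>" and U: "finite U" and \<pi>: "\<And>k u. k < \<kappa> \<Longrightarrow> u \<notin> U \<Longrightarrow> \<pi> k u = 0"
  shows "first_order_norm \<kappa> f \<pi> = (\<Sum>k<\<kappa>. (\<Sum>w\<in>U. \<Sum>l<\<kappa>. f w $$ (k, l) * \<pi> l w)\<^sup>2)"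
proof -
  have "(\<Sum>w\<in>ncp_support f. \<Sum>l<\<kappa>. f w $$ (k, l) * \<pi> l w) = (\<Sum>w\<in>U. \<Sum>l<\<kappa>. f w $$ (k, l) * \<pi> l w)"
    if "k < \<kappa>" for k
    using f U \<pi> coeff_outside_support[OF f _ that]
    by (intro sum.mono_neutral_cong) (auto simp: ncpolys_def)
  then show ?thesis by (simp add: first_order_norm_def)
qed

definition words_of_length :: "nat \<Rightarrow> nat \<Rightarrow> nat list set" where
  "words_of_length g j = {w \<in> lists {..<g}. length w = j}"

lemma finite_words_of_length: "finite (words_of_length g j)"
  by (rule finite_subset[OF _ finite_words[of g j]]) (auto simp: words_of_length_def words_def)

text \<open>A vector in the domain of the block row is a family \<open>\<xi>\<close> of vectors indexed by words, and
the block row sends it to \<open>\<Sum>\<^sub>v C\<^sub>v \<xi>\<^sub>v\<close>.\<close>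

lemma mat_range_block_row:
  "mat_range (block_row g \<kappa> j f) =
     {vec \<kappa> (\<lambda>a. \<Sum>v\<in>words_of_length g j. \<Sum>l<\<kappa>. f v $$ (a, l) * \<xi> l v) | \<xi>. True}"
proof -
  define ws where "ws = List.n_lists j [0..<g]"
  have dist: "distinct ws" by (simp add: ws_def distinct_n_lists)
  have set: "set ws = words_of_length g j"
    by (auto simp: ws_def set_n_lists words_of_length_def)
  have bij: "bij_betw ((!) ws) {..<length ws} (words_of_length g j)"
    using bij_betw_nth[OF dist refl set[symmetric]] .
  have bij2: "bij_betw (\<lambda>b. (b div \<kappa>, b mod \<kappa>)) {..<length ws * \<kappa>} ({..<length ws} \<times> {..<\<kappa>})"
    using bij_enum[of "\<lambda>i. i" \<kappa> "{..<\<kappa>}" "length ws"] by (simp add: bij_betw_def)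
  have dims: "dim_col (block_row g \<kappa> j f) = length ws * \<kappa>"
    by (simp add: block_row_def ws_def Let_def)
  have mult: "block_row g \<kappa> j f *\<^sub>v x =
      vec \<kappa> (\<lambda>a. \<Sum>v\<in>words_of_length g j. \<Sum>l<\<kappa>. f v $$ (a, l) * \<xi> l v)"
    if x: "x \<in> carrier_vec (length ws * \<kappa>)"
      "\<And>b. b < length ws * \<kappa> \<Longrightarrow> x $ b = \<xi> (b mod \<kappa>) (ws ! (b div \<kappa>))" for x \<xi>
  proof (rule eq_vecI)
    show "dim_vec (block_row g \<kappa> j f *\<^sub>v x) =
        dim_vec (vec \<kappa> (\<lambda>a. \<Sum>v\<in>words_of_length g j. \<Sum>l<\<kappa>. f v $$ (a, l) * \<xi> l v))"
      by (simp add: block_row_def Let_def)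
    fix a assume "a < dim_vec (vec \<kappa> (\<lambda>a. \<Sum>v\<in>words_of_length g j. \<Sum>l<\<kappa>. f v $$ (a, l) * \<xi> l v))"
    then have a: "a < \<kappa>" "a < dim_row (block_row g \<kappa> j f)" by (simp_all add: block_row_def Let_def)
    have "row (block_row g \<kappa> j f) a \<bullet> x =
        (\<Sum>b<length ws * \<kappa>. f (ws ! (b div \<kappa>)) $$ (a, b mod \<kappa>) * \<xi> (b mod \<kappa>) (ws ! (b div \<kappa>)))"
      using a x by (auto simp: block_row_def Let_def ws_def[symmetric] scalar_prod_def lessThan_atLeast0 intro!: sum.cong)
    also have "\<dots> = (\<Sum>(r, l)\<in>{..<length ws} \<times> {..<\<kappa>}. f (ws ! r) $$ (a, l) * \<xi> l (ws ! r))"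
      using sum.reindex_bij_betw[OF bij2, of "\<lambda>(r, l). f (ws ! r) $$ (a, l) * \<xi> l (ws ! r)"] by simp
    also have "\<dots> = (\<Sum>r<length ws. \<Sum>l<\<kappa>. f (ws ! r) $$ (a, l) * \<xi> l (ws ! r))"
      by (simp add: sum.cartesian_product)
    also have "\<dots> = (\<Sum>v\<in>words_of_length g j. \<Sum>l<\<kappa>. f v $$ (a, l) * \<xi> l v)"
      by (rule sum.reindex_bij_betw[OF bij])
    finally show "(block_row g \<kappa> j f *\<^sub>v x) $ a =
        vec \<kappa> (\<lambda>a. \<Sum>v\<in>words_of_length g j. \<Sum>l<\<kappa>. f v $$ (a, l) * \<xi> l v) $ a"
      using a by simp
  qed
  show ?thesis
  proof (intro equalityI subsetI)
    fix y assume "y \<in> mat_range (block_row g \<kappa> j f)"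
    then obtain x where x: "x \<in> carrier_vec (length ws * \<kappa>)" "y = block_row g \<kappa> j f *\<^sub>v x"
      by (auto simp: mat_range_def dims)
    define \<xi> where "\<xi> l v = x $ (inv_into {..<length ws} ((!) ws) v * \<kappa> + l)" for l v
    have "x $ b = \<xi> (b mod \<kappa>) (ws ! (b div \<kappa>))" if "b < length ws * \<kappa>" for b
      using bij_betw_inv_into_left[OF bij, of "b div \<kappa>"] that
      by (simp add: \<xi>_def less_mult_imp_div_less)
    from mult[OF x(1) this] x(2)
    show "y \<in> {vec \<kappa> (\<lambda>a. \<Sum>v\<in>words_of_length g j. \<Sum>l<\<kappa>. f v $$ (a, l) * \<xi> l v) | \<xi>. True}"
      by blast
  next
    fix y assume "y \<in> {vec \<kappa> (\<lambda>a. \<Sum>v\<in>words_of_length g j. \<Sum>l<\<kappa>. f v $$ (a, l) * \<xi> l v) | \<xi>. True}"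
    then obtain \<xi> where y: "y = vec \<kappa> (\<lambda>a. \<Sum>v\<in>words_of_length g j. \<Sum>l<\<kappa>. f v $$ (a, l) * \<xi> l v)"
      by blast
    define x where "x = vec (length ws * \<kappa>) (\<lambda>b. \<xi> (b mod \<kappa>) (ws ! (b div \<kappa>)))"
    have "y = block_row g \<kappa> j f *\<^sub>v x" unfolding y by (rule mult[symmetric]) (auto simp: x_def)
    moreover have "x \<in> carrier_vec (length ws * \<kappa>)" by (simp add: x_def)
    ultimately show "y \<in> mat_range (block_row g \<kappa> j f)" by (auto simp: mat_range_def dims)
  qed
qed

text \<open>The form in which majorization is used: a combination of coefficients of lower degree can be
cancelled by one of coefficients of top degree.\<close>

lemma highest_degree_majorizesD:
  assumes "highest_degree_majorizes g \<kappa> f" "1 \<le> j" "j < ncp_degree f"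
  shows "\<exists>\<chi>. \<forall>a<\<kappa>.
    (\<Sum>v\<in>words_of_length g (ncp_degree f). \<Sum>l<\<kappa>. f v $$ (a, l) * \<chi> l v) =
    (\<Sum>v\<in>words_of_length g j. \<Sum>l<\<kappa>. f v $$ (a, l) * \<xi> l v)"
proof -
  have "vec \<kappa> (\<lambda>a. \<Sum>v\<in>words_of_length g j. \<Sum>l<\<kappa>. f v $$ (a, l) * \<xi> l v)
     \<in> mat_range (block_row g \<kappa> (ncp_degree f) f)"
  proof (rule subsetD)
    show "mat_range (block_row g \<kappa> j f) \<subseteq> mat_range (block_row g \<kappa> (ncp_degree f) f)"
      using assms by (simp add: highest_degree_majorizes_def)
    show "vec \<kappa> (\<lambda>a. \<Sum>v\<in>words_of_length g j. \<Sum>l<\<kappa>. f v $$ (a, l) * \<xi> l v)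
        \<in> mat_range (block_row g \<kappa> j f)"
      unfolding mat_range_block_row by (intro CollectI exI[of _ \<xi>] conjI refl TrueI)
  qed
  then obtain \<chi> where \<chi>: "vec \<kappa> (\<lambda>a. \<Sum>v\<in>words_of_length g j. \<Sum>l<\<kappa>. f v $$ (a, l) * \<xi> l v) =
     vec \<kappa> (\<lambda>a. \<Sum>v\<in>words_of_length g (ncp_degree f). \<Sum>l<\<kappa>. f v $$ (a, l) * \<chi> l v)"
    unfolding mat_range_block_row by blast
  show ?thesis
  proof (intro exI[of _ \<chi>] allI impI)
    fix a assume "a < \<kappa>"
    then show "(\<Sum>v\<in>words_of_length g (ncp_degree f). \<Sum>l<\<kappa>. f v $$ (a, l) * \<chi> l v) =
        (\<Sum>v\<in>words_of_length g j. \<Sum>l<\<kappa>. f v $$ (a, l) * \<xi> l v)"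
      using arg_cong[OF \<chi>, of "\<lambda>y. y $ a"] by simp
  qed
qed

section \<open>Degree and positivity\<close>

locale majorizing_quasiconvex =
  fixes g \<kappa> :: nat and f :: ncpoly and \<gamma> :: real
  assumes f: "f \<in> ncpolys g \<kappa> \<kappa>" and symmetric: "ncp_symmetric f" and zero: "f [] = 0\<^sub>m \<kappa> \<kappa>"
    and \<gamma>: "0 < \<gamma>" and quasiconvex: "quasiconvex_below g \<kappa> \<gamma> f"
    and majorizes: "highest_degree_majorizes g \<kappa> f"
begin

lemma pairing_inequality:
  assumes "finite U" "[] \<notin> U" "\<And>k u. k < \<kappa> \<Longrightarrow> u \<notin> U \<Longrightarrow> \<pi> k u = 0"
  shows "0 \<le> (\<Sum>u\<in>U. \<Sum>v\<in>U. pairing \<kappa> f \<pi> u v)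
    + (\<Sum>k<\<kappa>. (\<Sum>w\<in>U. \<Sum>l<\<kappa>. f w $$ (k, l) * \<pi> l w)\<^sup>2) / \<gamma>"
proof -
  define \<rho> where "\<rho> k u = (if u \<in> U then \<pi> k u else 0)" for k u
  have "0 \<le> second_order_form \<kappa> f \<rho> + first_order_norm \<kappa> f \<rho> / \<gamma>"
    using assms by (intro second_order_inequality[OF f symmetric zero quasiconvex \<gamma>]) (auto simp: \<rho>_def)
  moreover have "second_order_form \<kappa> f \<rho> = (\<Sum>u\<in>U. \<Sum>v\<in>U. pairing \<kappa> f \<pi> u v)"
    using assms
    by (subst second_order_form_pairing[OF f assms(1,2)]) (auto simp: \<rho>_def pairing_def)
  moreover have "first_order_norm \<kappa> f \<rho> = (\<Sum>k<\<kappa>. (\<Sum>w\<in>U. \<Sum>l<\<kappa>. f w $$ (k, l) * \<pi> l w)\<^sup>2)"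
    by (subst first_order_norm_support[OF f assms(1)]) (auto simp: \<rho>_def)
  ultimately show ?thesis by simp
qed

text \<open>Let \<open>d \<ge> 3\<close> be the degree and \<open>w = i w\<^sub>0\<close> a word of length \<open>d\<close> in the support. By
majorization some \<open>\<rho> = w\<^sub>0 \<xi> - \<Sum>\<^sub>|\<^sub>v\<^sub>|\<^sub>=\<^sub>d v \<chi>\<^sub>v\<close> has \<open>\<Sum> C\<^sub>v \<rho>\<^sub>v = 0\<close>. All words in \<open>\<rho>\<close> have length at
least \<open>d - 1\<close> and \<open>2 (d - 1) > d\<close>, so \<open>\<rho>\<close> is isotropic for the Hankel form. The inequality
for \<open>\<rho> + t \<eta> i\<close> then is a quadratic in \<open>t\<close> without constant term, so its linear term,
\<open>2 t \<langle>C\<^sub>w \<xi>, \<eta>\<rangle>\<close>, must vanish.\<close>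

lemma degree_le_2: "ncp_degree f \<le> 2"
proof (rule ccontr)
  assume "\<not> ncp_degree f \<le> 2"
  define d where "d = ncp_degree f"
  have d: "3 \<le> d" using \<open>\<not> ncp_degree f \<le> 2\<close> by (simp add: d_def)
  have "finite (insert 0 (length ` ncp_support f))" using f by (simp add: ncpolys_def)
  from Max_in[OF this] have "d \<in> insert 0 (length ` ncp_support f)"
    by (simp add: d_def ncp_degree_def)
  then obtain w where w: "w \<in> ncp_support f" "length w = d" using d by auto
  then obtain i w\<^sub>0 where iw: "w = i # w\<^sub>0" using d by (cases w) auto
  have w\<^sub>0: "i < g" "w\<^sub>0 \<in> lists {..<g}" "length w\<^sub>0 = d - 1"
    using f w iw by (auto simp: ncpolys_def)
  have fw: "f w \<in> carrier_mat \<kappa> \<kappa>" using f by (simp add: ncpolys_def)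
  have "\<exists>k<\<kappa>. \<exists>l<\<kappa>. f w $$ (k, l) \<noteq> 0"
  proof (rule ccontr)
    assume "\<not> ?thesis"
    then have "f w = 0\<^sub>m (dim_row (f w)) (dim_col (f w))" using fw by (intro eq_matI) auto
    then show False using w by (simp add: ncp_support_def)
  qed
  then obtain k\<^sub>0 l\<^sub>0 where kl: "k\<^sub>0 < \<kappa>" "l\<^sub>0 < \<kappa>" "f w $$ (k\<^sub>0, l\<^sub>0) \<noteq> 0" by blast
  have "1 \<le> d - 1" "d - 1 < ncp_degree f" using d by (auto simp: d_def)
  from highest_degree_majorizesD[OF majorizes this, of "\<lambda>l v. if v = w\<^sub>0 \<and> l = l\<^sub>0 then 1 else 0"]
  obtain \<chi> where \<chi>: "\<And>a. a < \<kappa> \<Longrightarrow>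
      (\<Sum>v\<in>words_of_length g d. \<Sum>l<\<kappa>. f v $$ (a, l) * \<chi> l v) =
      (\<Sum>v\<in>words_of_length g (d - 1). \<Sum>l<\<kappa>. f v $$ (a, l) * (if v = w\<^sub>0 \<and> l = l\<^sub>0 then 1 else 0))"
    unfolding d_def[symmetric] by blast
  have \<chi>0: "(\<Sum>v\<in>words_of_length g d. \<Sum>l<\<kappa>. f v $$ (a, l) * \<chi> l v) = f w\<^sub>0 $$ (a, l\<^sub>0)" if "a < \<kappa>" for a
  proof -
    have "(\<Sum>l<\<kappa>. f v $$ (a, l) * (if v = w\<^sub>0 \<and> l = l\<^sub>0 then 1 else 0)) =
        (if v = w\<^sub>0 then f w\<^sub>0 $$ (a, l\<^sub>0) else 0)" for v
      using kl by (auto simp: if_distrib[of "\<lambda>c. _ * c"] cong: if_cong)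
    moreover have "w\<^sub>0 \<in> words_of_length g (d - 1)" using w\<^sub>0 by (simp add: words_of_length_def)
    ultimately show ?thesis using \<chi>[OF that] finite_words_of_length by simp
  qed
  define D where "D = words_of_length g d"
  define U where "U = insert [i] (insert w\<^sub>0 D)"
  have distinct: "[i] \<noteq> w\<^sub>0" "[i] \<notin> D" "w\<^sub>0 \<notin> D" "finite D"
    using w\<^sub>0 d finite_words_of_length by (auto simp: D_def words_of_length_def)
  have lenD: "length v = d" if "v \<in> D" for v using that by (simp add: D_def words_of_length_def)
  have U: "finite U" "[] \<notin> U" using distinct(4) w\<^sub>0 d lenD[of "[]"] by (auto simp: U_def)
  \<comment> \<open>The vectors \<open>\<xi>\<close> and \<open>\<eta>\<close> are the unit vectors at a nonzero entry of \<open>C\<^sub>w\<close>.\<close>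
  define \<pi> where "\<pi> t k u = (if u = [i] then if k = k\<^sub>0 then t else 0
      else if u = w\<^sub>0 then if k = l\<^sub>0 then 1 else 0
      else if u \<in> D then - \<chi> k u else (0::real))" for t k u
  have pair_i_w: "pairing \<kappa> f (\<pi> t) [i] w\<^sub>0 = t * f w $$ (k\<^sub>0, l\<^sub>0)" for t
    using kl distinct(1) by (simp add: pairing_def \<pi>_def iw if_distrib[of "\<lambda>c. _ * c"] if_distrib[of "\<lambda>c. c * _"] mult_ac cong: if_cong)
  have pair_i_i: "pairing \<kappa> f (\<pi> t) [i] [i] = t\<^sup>2 * f [i, i] $$ (k\<^sub>0, k\<^sub>0)" for t
    using kl by (simp add: pairing_def \<pi>_def power2_eq_square if_distrib[of "\<lambda>c. _ * c"] if_distrib[of "\<lambda>c. c * _"] mult_ac cong: if_cong)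
  have pair0: "pairing \<kappa> f (\<pi> t) u v = 0" if "u \<in> U" "v \<in> U" "u \<in> D \<or> v \<in> D \<or> u = w\<^sub>0 \<and> v = w\<^sub>0" for t u v
    using that d w\<^sub>0(3) distinct(2)
    by (intro pairing_degree[OF f]) (auto simp: U_def lenD d_def[symmetric])
  have second: "(\<Sum>u\<in>U. \<Sum>v\<in>U. pairing \<kappa> f (\<pi> t) u v) =
      t\<^sup>2 * f [i, i] $$ (k\<^sub>0, k\<^sub>0) + 2 * t * f w $$ (k\<^sub>0, l\<^sub>0)" for t
  proof -
    have sumU: "(\<Sum>u\<in>U. F u) = F [i] + F w\<^sub>0 + (\<Sum>u\<in>D. F u)" for F :: "nat list \<Rightarrow> real"
      using distinct by (simp add: U_def)
    have "(\<Sum>v\<in>D. pairing \<kappa> f (\<pi> t) u v) = 0" if "u \<in> U" for u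
      using that pair0 by (auto intro!: sum.neutral simp: U_def)
    moreover have "(\<Sum>u\<in>D. \<Sum>v\<in>U. pairing \<kappa> f (\<pi> t) u v) = 0"
      using pair0 by (auto intro!: sum.neutral simp: U_def)
    moreover have "[i] \<in> U" "w\<^sub>0 \<in> U" by (simp_all add: U_def)
    ultimately have "(\<Sum>u\<in>U. \<Sum>v\<in>U. pairing \<kappa> f (\<pi> t) u v) =
        pairing \<kappa> f (\<pi> t) [i] [i] + pairing \<kappa> f (\<pi> t) [i] w\<^sub>0 +
        (pairing \<kappa> f (\<pi> t) w\<^sub>0 [i] + pairing \<kappa> f (\<pi> t) w\<^sub>0 w\<^sub>0)"
      unfolding sumU[of "\<lambda>u. \<Sum>v\<in>U. pairing \<kappa> f (\<pi> t) u v"] by (simp add: sumU)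
    then show ?thesis
      using pairing_sym[OF f symmetric, of "\<pi> t" w\<^sub>0 "[i]"] pair0[of w\<^sub>0 w\<^sub>0 t] pair_i_i pair_i_w
      by (simp add: U_def)
  qed
  have first: "(\<Sum>w\<in>U. \<Sum>l<\<kappa>. f w $$ (k, l) * \<pi> t l w) = t * f [i] $$ (k, k\<^sub>0)" if "k < \<kappa>" for k t
  proof -
    have "(\<Sum>v\<in>D. \<Sum>l<\<kappa>. f v $$ (k, l) * \<pi> t l v) = - (\<Sum>v\<in>D. \<Sum>l<\<kappa>. f v $$ (k, l) * \<chi> l v)"
      using distinct unfolding sum_negf[symmetric]
      by (intro sum.cong refl) (auto simp: \<pi>_def)
    also have "\<dots> = - f w\<^sub>0 $$ (k, l\<^sub>0)" using \<chi>0[OF that] by (simp add: D_def)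
    finally have 1: "(\<Sum>v\<in>D. \<Sum>l<\<kappa>. f v $$ (k, l) * \<pi> t l v) = - f w\<^sub>0 $$ (k, l\<^sub>0)" .
    have 2: "(\<Sum>l<\<kappa>. f [i] $$ (k, l) * \<pi> t l [i]) = t * f [i] $$ (k, k\<^sub>0)"
      using kl by (simp add: \<pi>_def if_distrib[of "\<lambda>c. _ * c"] cong: if_cong)
    have 3: "(\<Sum>l<\<kappa>. f w\<^sub>0 $$ (k, l) * \<pi> t l w\<^sub>0) = f w\<^sub>0 $$ (k, l\<^sub>0)"
      using kl distinct by (simp add: \<pi>_def if_distrib[of "\<lambda>c. _ * c"] cong: if_cong)
    show ?thesis
      unfolding U_def using distinct by (simp add: 1 2 3)
  qed
  have "0 \<le> t\<^sup>2 * (f [i, i] $$ (k\<^sub>0, k\<^sub>0) + (\<Sum>k<\<kappa>. (f [i] $$ (k, k\<^sub>0))\<^sup>2) / \<gamma>) + 2 * t * f w $$ (k\<^sub>0, l\<^sub>0)" for t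
  proof -
    have "\<pi> t k u = 0" if "u \<notin> U" for k u using that by (auto simp: \<pi>_def U_def)
    from pairing_inequality[where \<pi> = "\<pi> t", OF U this]
    have "0 \<le> t\<^sup>2 * f [i, i] $$ (k\<^sub>0, k\<^sub>0) + 2 * t * f w $$ (k\<^sub>0, l\<^sub>0)
        + (\<Sum>k<\<kappa>. (t * f [i] $$ (k, k\<^sub>0))\<^sup>2) / \<gamma>"
      unfolding second by (simp add: first)
    then show ?thesis
      by (simp add: power_mult_distrib sum_distrib_left[symmetric] algebra_simps)
  qed
  from quadratic_nonneg_imp_linear_zero[OF this] show False using kl(3) by simp
qed

text \<open>In degree \<open>2\<close> the first order term of \<open>\<Sum>\<^sub>j x\<^sub>j y\<^sub>j\<close> can be cancelled, by majorization, with words of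
length \<open>2\<close>. Paired with a nonempty word they give words of length at least \<open>3\<close>, so they leave the Hankel form
unchanged.\<close>

lemma quadratic_part_positive:
  "0 \<le> (\<Sum>i<g. \<Sum>j<g. \<Sum>k<\<kappa>. \<Sum>l<\<kappa>. f [i, j] $$ (k, l) * (y i k * y j l))"
proof (cases "ncp_degree f = 2")
  case False
  then have "ncp_degree f < 2" using degree_le_2 by simp
  then have "f [i, j] $$ (k, l) = 0" if "k < \<kappa>" "l < \<kappa>" for i j k l
    using length_le_degree[OF f, of "[i, j]"] that by (intro coeff_outside_support[OF f]) auto
  then show ?thesis by simp
next
  case True
  define D where "D = words_of_length g 2"
  define L where "L = (\<lambda>i. [i]) ` {..<g}"
  have L: "words_of_length g 1 = L"
    by (auto simp: words_of_length_def L_def length_Suc_conv)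
  have "1 < ncp_degree f" using True by simp
  from highest_degree_majorizesD[OF majorizes order_refl this, of "\<lambda>l v. y (hd v) l"]
  obtain \<chi> where \<chi>: "\<And>a. a < \<kappa> \<Longrightarrow>
      (\<Sum>v\<in>D. \<Sum>l<\<kappa>. f v $$ (a, l) * \<chi> l v) = (\<Sum>v\<in>L. \<Sum>l<\<kappa>. f v $$ (a, l) * y (hd v) l)"
    unfolding L D_def True by blast
  define \<pi> where "\<pi> k u = (if u \<in> L then y (hd u) k else if u \<in> D then - \<chi> k u else 0)" for k u
  have LD: "L \<inter> D = {}" "finite L" "finite D" "[] \<notin> L \<union> D"
    using finite_words_of_length by (auto simp: L_def D_def words_of_length_def)
  have pair0: "pairing \<kappa> f \<pi> u v = 0" if "u \<in> D \<and> v \<in> L \<union> D \<or> u \<in> L \<union> D \<and> v \<in> D" for u v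
    using that True by (intro pairing_degree[OF f]) (auto simp: D_def L_def words_of_length_def)
  have second: "(\<Sum>u\<in>L \<union> D. \<Sum>v\<in>L \<union> D. pairing \<kappa> f \<pi> u v) = (\<Sum>u\<in>L. \<Sum>v\<in>L. pairing \<kappa> f \<pi> u v)"
    using LD pair0 by (simp add: sum.union_disjoint)
  have "(\<Sum>w\<in>L \<union> D. \<Sum>l<\<kappa>. f w $$ (k, l) * \<pi> l w) = 0" if "k < \<kappa>" for k
  proof -
    have "(\<Sum>w\<in>L \<union> D. \<Sum>l<\<kappa>. f w $$ (k, l) * \<pi> l w) =
       (\<Sum>v\<in>L. \<Sum>l<\<kappa>. f v $$ (k, l) * \<pi> l v) + (\<Sum>v\<in>D. \<Sum>l<\<kappa>. f v $$ (k, l) * \<pi> l v)"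
      using LD by (simp add: sum.union_disjoint)
    also have "(\<Sum>v\<in>L. \<Sum>l<\<kappa>. f v $$ (k, l) * \<pi> l v) = (\<Sum>v\<in>L. \<Sum>l<\<kappa>. f v $$ (k, l) * y (hd v) l)"
      by (intro sum.cong refl) (auto simp: \<pi>_def)
    also have "(\<Sum>v\<in>D. \<Sum>l<\<kappa>. f v $$ (k, l) * \<pi> l v) = - (\<Sum>v\<in>D. \<Sum>l<\<kappa>. f v $$ (k, l) * \<chi> l v)"
      using LD unfolding sum_negf[symmetric] by (intro sum.cong refl) (auto simp: \<pi>_def)
    finally show ?thesis using \<chi>[OF that] by simp
  qed
  moreover have "0 \<le> (\<Sum>u\<in>L \<union> D. \<Sum>v\<in>L \<union> D. pairing \<kappa> f \<pi> u v)
    + (\<Sum>k<\<kappa>. (\<Sum>w\<in>L \<union> D. \<Sum>l<\<kappa>. f w $$ (k, l) * \<pi> l w)\<^sup>2) / \<gamma>"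
    using LD by (intro pairing_inequality) (auto simp: \<pi>_def)
  ultimately have "0 \<le> (\<Sum>u\<in>L. \<Sum>v\<in>L. pairing \<kappa> f \<pi> u v)" by (simp add: second)
  also have "\<dots> = (\<Sum>i<g. \<Sum>j<g. pairing \<kappa> f \<pi> [i] [j])"
    by (simp add: L_def sum.reindex inj_on_def)
  also have "\<dots> = (\<Sum>i<g. \<Sum>j<g. \<Sum>k<\<kappa>. \<Sum>l<\<kappa>. f [i, j] $$ (k, l) * (y i k * y j l))"
    by (intro sum.cong refl) (auto simp: pairing_def \<pi>_def L_def intro!: sum.cong)
  finally show ?thesis .
qed

end

section \<open>Assembling the sum of squares\<close>

lemma gram_product:
  fixes g \<kappa> :: nat and s :: "nat \<times> nat \<Rightarrow> real"
  defines "S \<equiv> (\<lambda>w. mat 1 \<kappa> (\<lambda>(_, l). if length w = 1 \<and> hd w < g then s (hd w, l) else 0))"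
  assumes "k < \<kappa>" "l < \<kappa>"
  shows "ncp_mult (ncp_transpose S) S w $$ (k, l) =
    (if length w = 2 \<and> w \<in> lists {..<g} then s (w ! 0, k) * s (w ! 1, l) else 0)"
proof -
  have "ncp_mult (ncp_transpose S) S w $$ (k, l) =
     (\<Sum>i\<le>length w. S (rev (take i w)) $$ (0, k) * S (drop i w) $$ (0, l))"
    using assms by (auto simp: ncp_mult_def matsum_def ncp_transpose_def S_def scalar_prod_def intro!: sum.cong)
  also have "\<dots> = (\<Sum>i\<le>length w. if i = 1 then
      (if length w = 2 \<and> w \<in> lists {..<g} then s (w ! 0, k) * s (w ! 1, l) else 0) else 0)"
  proof (rule sum.cong[OF refl])
    fix i assume i: "i \<in> {..length w}"
    show "S (rev (take i w)) $$ (0, k) * S (drop i w) $$ (0, l) = (if i = 1 then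
      (if length w = 2 \<and> w \<in> lists {..<g} then s (w ! 0, k) * s (w ! 1, l) else 0) else 0)"
    proof (cases "i = 1 \<and> length w = 2")
      case True
      then obtain a b where "w = [a, b]" by (auto simp: length_Suc_conv numeral_2_eq_2)
      then show ?thesis using True assms(2,3) by (auto simp: S_def)
    next
      case False
      then have "length (take i w) \<noteq> 1 \<or> length (drop i w) \<noteq> 1" using i by auto
      then show ?thesis using False assms(2,3) by (auto simp: S_def)
    qed
  qed
  also have "\<dots> = (if length w = 2 \<and> w \<in> lists {..<g} then s (w ! 0, k) * s (w ! 1, l) else 0)"
    by simp
  finally show ?thesis .
qed

text \<open>The zero tuple of \<open>1 \<times> 1\<close> matrices kills every word but the empty one.\<close>

lemma constant_coefficient_zero:
  assumes f: "f \<in> ncpolys g \<kappa> \<kappa>"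
    and zero: "ncp_eval 1 f (\<lambda>i\<in>{..<g}. 0\<^sub>m 1 1) = 0\<^sub>m \<kappa> \<kappa>"
  shows "f [] = 0\<^sub>m \<kappa> \<kappa>"
proof -
  have h: "bij_betw (\<lambda>_. ()) {..<1::nat} {()}" by (auto simp: bij_betw_def inj_on_def)
  have "enum_tuple g 1 (\<lambda>_. ()) (\<lambda>_ _ _. 0) = (\<lambda>i\<in>{..<g}. 0\<^sub>m 1 1)"
    by (auto simp: enum_tuple_def restrict_def fun_eq_iff intro!: eq_matI)
  then have E: "enum_mat \<kappa> 1 (\<lambda>_. ()) (eval_kernel {()} f (\<lambda>_ _ _. 0)) = 0\<^sub>m \<kappa> \<kappa>"
    using ncp_eval_enum_tuple[OF h f, of "\<lambda>_ _ _. 0"] zero by simp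
  have carrier: "f [] \<in> carrier_mat \<kappa> \<kappa>" using f by (simp add: ncpolys_def)
  have "f [] $$ (k, l) = 0" if kl: "k < \<kappa>" "l < \<kappa>" for k l
  proof -
    have word: "act {()} (\<lambda>_ _ _. 0) w v () = (if w = [] then v () else 0)" for w and v :: "unit \<Rightarrow> real"
      by (cases w) auto
    have "0 = eval_kernel {()} f (\<lambda>_ _ _. 0) (k, ()) (l, ())"
      using arg_cong[OF E, of "\<lambda>A. A $$ (k, l)"] kl by (simp add: enum_mat_def)
    also have "\<dots> = (\<Sum>w\<in>ncp_support f. if w = [] then f [] $$ (k, l) else 0)"
      unfolding eval_kernel_def by (rule sum.cong) (auto simp: word)
    also have "\<dots> = (if [] \<in> ncp_support f then f [] $$ (k, l) else 0)"
      using f by (intro sum.delta) (simp add: ncpolys_def)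
    finally show ?thesis using coeff_outside_support[OF f _ kl] by (auto split: if_splits)
  qed
  then show ?thesis using carrier by (intro eq_matI) auto
qed

text \<open>As the degree is at most \<open>2\<close>, the part of degree at most one is \<open>l\<close>, and the Gram vectors of the
positive semidefinite matrix of quadratic coefficients \<open>C\<^sub>i\<^sub>j\<close> are the coefficients of the \<open>s\<^sub>j\<close>.\<close>

theorem theorem1p2:
  fixes g \<kappa> :: nat and f :: ncpoly
  assumes "1 \<le> g" and "1 \<le> \<kappa>"
    and "f \<in> ncpolys g \<kappa> \<kappa>" and "ncp_symmetric f"
    and "highest_degree_majorizes g \<kappa> f"
    and "\<forall>n\<ge>1. ncp_eval n f (\<lambda>i\<in>{..<g}. 0\<^sub>m n n) = 0\<^sub>m (\<kappa> * n) (\<kappa> * n)"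
    and "\<exists>\<gamma>>0. \<forall>n\<ge>1. \<forall>M \<in> symmetric_mats (\<kappa> * n). M \<prec>\<^sub>L \<gamma> \<cdot>\<^sub>m 1\<^sub>m (\<kappa> * n) \<longrightarrow>
           {X \<in> sym_tuples n g. ncp_eval n f X \<prec>\<^sub>L M} \<subset> sym_tuples n g \<and>
           convex_tuples g {X \<in> sym_tuples n g. ncp_eval n f X \<prec>\<^sub>L M}"
  shows "\<exists>l N s. l \<in> ncpolys g \<kappa> \<kappa> \<and> ncp_symmetric l \<and> ncp_degree l \<le> 1 \<and>
           (\<forall>j<(N::nat). s j \<in> ncpolys g 1 \<kappa> \<and> ncp_homogeneous 1 (s j)) \<and>
           f = ncp_add l (ncp_sum \<kappa> \<kappa> (\<lambda>j. ncp_mult (ncp_transpose (s j)) (s j)) {..<N})"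
proof -
  note f = assms(3)
  obtain \<gamma> where \<gamma>: "0 < \<gamma>" "quasiconvex_below g \<kappa> \<gamma> f"
    using assms(7) unfolding quasiconvex_below_def by meson
  have "f [] = 0\<^sub>m \<kappa> \<kappa>"
    using constant_coefficient_zero[OF f] assms(6)[rule_format, of 1] by simp
  then interpret majorizing_quasiconvex g \<kappa> f \<gamma>
    using assms \<gamma> by unfold_locales auto
  have carrier: "f w \<in> carrier_mat \<kappa> \<kappa>" for w using f by (simp add: ncpolys_def)
  have carrier_dims: "dim_row (f w) = \<kappa>" "dim_col (f w) = \<kappa>" for w using carrier[of w] by auto
  define I where "I = {..<g} \<times> {..<\<kappa>}"
  define A where "A p q = f [fst p, fst q] $$ (snd p, snd q)" for p q :: "nat \<times> nat"
  have "\<exists>N s. \<forall>p\<in>I. \<forall>q\<in>I. A p q = (\<Sum>m<(N::nat). s m p * s m q)"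
  proof (rule positive_semidefinite_gram)
    show "finite I" by (simp add: I_def)
    show "A p q = A q p" if "p \<in> I" "q \<in> I" for p q
      using symmetric_coeff[OF symmetric f, of "snd p" "snd q" "[fst q, fst p]"] that
      by (auto simp: A_def I_def)
    show "0 \<le> quadratic_form I A v" for v
    proof -
      have "quadratic_form I A v =
          (\<Sum>i<g. \<Sum>k<\<kappa>. \<Sum>j<g. \<Sum>l<\<kappa>. f [i, j] $$ (k, l) * (v (i, k) * v (j, l)))"
        unfolding quadratic_form_def I_def sum.cartesian_product' A_def by (simp add: mult_ac)
      also have "\<dots> = (\<Sum>i<g. \<Sum>j<g. \<Sum>k<\<kappa>. \<Sum>l<\<kappa>. f [i, j] $$ (k, l) * (v (i, k) * v (j, l)))"
        by (intro sum.cong refl sum.swap)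
      finally show ?thesis using quadratic_part_positive[of "\<lambda>i k. v (i, k)"] by simp
    qed
  qed
  then obtain N s where s: "\<And>p q. p \<in> I \<Longrightarrow> q \<in> I \<Longrightarrow> A p q = (\<Sum>m<(N::nat). s m p * s m q)"
    by blast
  define S where "S m = (\<lambda>w. mat 1 \<kappa> (\<lambda>(_, l). if length w = 1 \<and> hd w < g then s m (hd w, l) else 0))"
    for m :: nat
  define l where "l w = (if length w \<le> 1 then f w else 0\<^sub>m \<kappa> \<kappa>)" for w
  have supp_l: "ncp_support l \<subseteq> {w \<in> ncp_support f. length w \<le> 1}"
    by (auto simp: ncp_support_def l_def split: if_splits)
  have l: "l \<in> ncpolys g \<kappa> \<kappa>"
    using f carrier supp_l finite_subset[OF supp_l] by (auto simp: ncpolys_def l_def)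
  have "ncp_symmetric l"
    using symmetric unfolding ncp_symmetric_def ncp_transpose_def fun_eq_iff l_def by auto
  moreover have "ncp_degree l \<le> 1"
    using l supp_l by (auto simp: ncp_degree_def ncpolys_def)
  moreover have "S m \<in> ncpolys g 1 \<kappa> \<and> ncp_homogeneous 1 (S m)" for m
  proof -
    have "S m w = 0\<^sub>m 1 \<kappa>" if "w \<notin> words_of_length g 1" for w
      using that by (cases w) (auto simp: S_def words_of_length_def intro!: eq_matI)
    then have supp: "ncp_support (S m) \<subseteq> words_of_length g 1"
      by (auto simp: ncp_support_def)
    have "finite (ncp_support (S m))"
      by (rule finite_subset[OF supp finite_words_of_length])
    moreover have "S m w \<in> carrier_mat 1 \<kappa>" for w by (simp add: S_def)
    ultimately show ?thesis
      using supp by (auto simp: ncpolys_def ncp_homogeneous_def words_of_length_def)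
  qed
  moreover have "f = ncp_add l (ncp_sum \<kappa> \<kappa> (\<lambda>m. ncp_mult (ncp_transpose (S m)) (S m)) {..<N})"
  proof
    fix w
    show "f w = ncp_add l (ncp_sum \<kappa> \<kappa> (\<lambda>m. ncp_mult (ncp_transpose (S m)) (S m)) {..<N}) w"
    proof (rule eq_matI)
      fix k k' assume "k < dim_row (ncp_add l (ncp_sum \<kappa> \<kappa> (\<lambda>m. ncp_mult (ncp_transpose (S m)) (S m)) {..<N}) w)"
        "k' < dim_col (ncp_add l (ncp_sum \<kappa> \<kappa> (\<lambda>m. ncp_mult (ncp_transpose (S m)) (S m)) {..<N}) w)"
      then have kk: "k < \<kappa>" "k' < \<kappa>" by (simp_all add: ncp_add_def ncp_sum_def matsum_def)
      have "ncp_add l (ncp_sum \<kappa> \<kappa> (\<lambda>m. ncp_mult (ncp_transpose (S m)) (S m)) {..<N}) w $$ (k, k') =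
         l w $$ (k, k') + (\<Sum>m<N. if length w = 2 \<and> w \<in> lists {..<g} then s m (w ! 0, k) * s m (w ! 1, k') else 0)"
      proof -
        have "ncp_mult (ncp_transpose (S m)) (S m) w $$ (k, k') =
            (if length w = 2 \<and> w \<in> lists {..<g} then s m (w ! 0, k) * s m (w ! 1, k') else 0)" for m
          unfolding S_def by (rule gram_product[OF kk])
        then show ?thesis using kk by (simp only: ncp_add_def ncp_sum_def matsum_def) simp
      qed
      also have "\<dots> = f w $$ (k, k')"
      proof (cases "length w = 2 \<and> w \<in> lists {..<g}")
        case True
        then obtain i j where w: "w = [i, j]" "i < g" "j < g"
          by (auto simp: length_Suc_conv numeral_2_eq_2)
        then show ?thesis using s[of "(i, k)" "(j, k')"] kk by (simp add: I_def A_def l_def)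
      next
        case False
        show ?thesis
        proof (cases "length w \<le> 1")
          case True
          then show ?thesis by (simp add: l_def)
        next
          case long: False
          have "w \<notin> ncp_support f"
            using False long degree_le_2 length_le_degree[OF f, of w] f by (auto simp: ncpolys_def)
          then have "f w $$ (k, k') = 0" by (rule coeff_outside_support[OF f _ kk])
          then show ?thesis unfolding if_not_P[OF False] using kk long by (simp add: l_def)
        qed
      qed
      finally show "f w $$ (k, k') =
          ncp_add l (ncp_sum \<kappa> \<kappa> (\<lambda>m. ncp_mult (ncp_transpose (S m)) (S m)) {..<N}) w $$ (k, k')" ..
    qed (simp_all add: carrier_dims ncp_add_def ncp_sum_def matsum_def)
  qed
  ultimately show ?thesis using l by blast
qed

end
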